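(* Let $k$ be a field and let $V$ be a two-dimensional $k$-vector space with basis $\{a,b\}$. If $m>5$ then $\Lambda^{S^2}_V(m)=0$. For $m\le 5$ the following sets $\mathcal B(m)$ (each listed element being the class in $\Lambda^{S^2}_V(m)$ of the indicated upper triangular tensor matrix) are $k$-bases of $\Lambda^{S^2}_V(m)$: - $\mathcal B(1)=\{\mathbf 1\}$, a basis of $\Lambda^{S^2}_V(1)$; - $\mathcal B(2)=\{\wedge(1)\}$, a basis of $\Lambda^{S^2}_V(2)$; - $\mathcal B(3)=\left\{\begin{pmatrix}1&a\\ \wedge&1\end{pmatrix},\ \begin{pmatrix}1&b\\ \wedge&1\end{pmatrix}\right\}$, a basis of $\Lambda^{S^2}_V(3)$; - $\mathcal B(4)=\left\{\begin{pmatrix}1&a&a\\&1&b\\ \wedge&&1\end{pmatrix},\ \begin{pmatrix}1&a&b\\&1&a\\ \wedge&&1\end{pmatrix},\ \begin{pmatrix}1&b&b\\&1&a\\ \wedge&&1\end{pmatrix},\ \begin{pmatrix}1&a&b\\&1&b\\ \wedge&&1\end{pmatrix}\right\}$, a basis of $\Lambda^{S^2}_V(4)$; - $\mathcal B(5)=\left\{\begin{pmatrix}1&a&b&b\\&1&a&b\\&&1&a\\ \wedge&&&1\end{pmatrix}\right\}$, a basis of $\Lambda^{S^2}_V(5)$.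
   Context: $k$ is a field, $\otimes=\otimes_k$, and $V^{\otimes 0}=k$. **Tensor spaces.** For $m\ge 1$ let $\mathcal T(m)=\mathcal T^{S^2}_V(m)=V^{\otimes \frac{(m-1)(m-2)}{2}}$, with tensor factors indexed by the pairs $(p,q)$ with $1\le p<q\le m-1$. A simple tensor $\otimes_{p<q}(u_{p,q})$ is written as an upper triangular $(m-1)\times(m-1)$ tensor matrix with diagonal entries $1$ and entries $u_{p,q}\in V$ above the diagonal. So $\mathcal T(1)$ and $\mathcal T(2)$ are one-dimensional; the element $1\in k$ is denoted $\mathbf 1$ in $\mathcal T(1)$ and $(1)$ in $\mathcal T(2)$. For $m,n\ge 1$ let $\mathcal B_V(m,n)=V^{\otimes (m-1)(n-1)}$, with factors indexed by positions in an $(m-1)\times(n-1)$ matrix; simple tensors are $\otimes_{r,s}(w_{r,s})$. Transposition of matrices gives a linear isomorphism $A\mapsto A^{tr}$, $\mathcal B_V(m,n)\to\mathcal B_V(n,m)$. **Operations.** For $m,n\ge1$ and $1\le i\le m$ there is a linear map $\diamond_i:\mathcal T(m)\otimes\mathcal B_V(m,n)\otimes\mathcal T(n)\to\mathcal T(m+n-1)$, defined on simple tensors $x=\otimes(u_{p,q})$, $A=\otimes(w_{r,s})$, $y=\otimes(v_{p,q})$ as follows (scalars are multiplied through when a space is $V^{\otimes 0}=k$). Among the indices $1,\dots,m+n-2$, call $i,\dots,i+n-2$ new and the others old; put $\sigma(p)=p$ for old $p<i$ and $\sigma(p)=p-(n-1)$ for old $p\ge i+n-1$. The result $\diamond_i(x,A,y)$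 is the simple tensor whose entry in position $(p,q)$, $p<q$, is $u_{\sigma(p),\sigma(q)}$ if $p,q$ are both old; $v_{p-i+1,q-i+1}$ if both are new; and $w_{\sigma(o),\,t-i+1}$ if one of $p,q$ is old, equal to $o$, and the other is new, equal to $t$. **Ideals.** An ideal of $\mathcal T^{S^2}_V$ is a family of subspaces $\mathcal I(m)\subseteq\mathcal T(m)$, $m\ge1$, such that for all $m,n\geq 1$, $x\in\mathcal I(m)$, $y\in\mathcal T(n)$, $A\in\mathcal B_V(m,n)$ we have $\diamond_i(x,A,y)\in\mathcal I(m+n-1)$ for $1\le i\le m$ and $\diamond_i(y,A^{tr},x)\in\mathcal I(m+n-1)$ for $1\le i\le n$. The ideal generated by a set is the smallest ideal containing it. **The exterior GSC-operad.** $\mathcal E^{S^2}_V$ is the ideal generated by all elements $\otimes\begin{pmatrix}1&v&v\\&1&v\\&&1\end{pmatrix}\in\mathcal T(4)$, $v\in V$, and $\Lambda^{S^2}_V(m)=\mathcal T^{S^2}_V(m)/\mathcal E^{S^2}_V(m)$. The class in $\Lambda^{S^2}_V(m)$ of a simple tensor matrix is written as the same matrix with the symbol $\wedge$ in the lower left corner (or in front of it, for $m=2$).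
   Formalization: For m = 4 and m = 5 the field k is assumed to have an element other than 0 and 1; over the field with two elements those two claims fail (the quotients have dimensions 5 and 6). The claims for m = 1, 2, 3 and m > 5 are for every field. *)

theory Defs
  imports
    "HOL-Library.Function_Algebras"
    "Jordan_Normal_Form.VS_Connect"
begin

section \<open>Tensor powers\<close>

text \<open>
  Throughout, a vector space over the field \<open>'k\<close> is a type \<open>'v\<close> together with a scalar
  multiplication \<open>scale\<close> satisfying the library locale \<open>vector_space\<close>.

  Functions with values in \<open>'k\<close> form a vector space pointwise.
\<close>

definition fscale :: "'k::field \<Rightarrow> ('x \<Rightarrow> 'k) \<Rightarrow> 'x \<Rightarrow> 'k" where
  "fscale c x = (\<lambda>z. c * x z)"

interpretation fun_vs: vector_space "fscale :: 'k::field \<Rightarrow> ('x \<Rightarrow> 'k) \<Rightarrow> 'x \<Rightarrow> 'k"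
  by unfold_locales (auto simp: fscale_def algebra_simps)

definition multilinear_on ::
  "('k::field \<Rightarrow> 'v::ab_group_add \<Rightarrow> 'v) \<Rightarrow> 'i set \<Rightarrow> (('i \<Rightarrow> 'v) \<Rightarrow> 'k) \<Rightarrow> bool" where
  "multilinear_on scale S \<phi> \<longleftrightarrow>
     (\<forall>f. \<forall>s\<in>S. Vector_Spaces.linear scale (*) (\<lambda>x. \<phi> (f(s := x)))) \<and>
     (\<forall>f g. (\<forall>s\<in>S. f s = g s) \<longrightarrow> \<phi> f = \<phi> g)"

text \<open>
  The tensor power of \<open>V\<close> with tensor factors indexed by \<open>S\<close> is realised inside the dual of the
  space of multilinear forms: the simple tensor with entries \<open>f s\<close> is evaluation of multilinear
  forms at \<open>f\<close>. Entries of \<open>f\<close> outside \<open>S\<close> are irrelevant, and for empty \<open>S\<close> the space is a copy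
  of \<open>k\<close> whose element \<open>1\<close> is the empty simple tensor. That this is the tensor power is
  \<open>multilinear_simple_tensor\<close> and \<open>tensor_power_universal\<close> below.
\<close>

type_synonym ('i, 'v, 'k) tensor = "(('i \<Rightarrow> 'v) \<Rightarrow> 'k) \<Rightarrow> 'k"

definition simple_tensor ::
  "('k::field \<Rightarrow> 'v::ab_group_add \<Rightarrow> 'v) \<Rightarrow> 'i set \<Rightarrow> ('i \<Rightarrow> 'v) \<Rightarrow> ('i, 'v, 'k) tensor" where
  "simple_tensor scale S f = (\<lambda>\<phi>. if multilinear_on scale S \<phi> then \<phi> f else 0)"

definition tensor_power ::
  "('k::field \<Rightarrow> 'v::ab_group_add \<Rightarrow> 'v) \<Rightarrow> 'i set \<Rightarrow> ('i, 'v, 'k) tensor set" where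
  "tensor_power scale S = fun_vs.span (range (simple_tensor scale S))"

section \<open>The tensor spaces and their operations\<close>

definition tri_pos :: "nat \<Rightarrow> (nat \<times> nat) set" where
  "tri_pos m = {(p, q). 1 \<le> p \<and> p < q \<and> q < m}"

definition rect_pos :: "nat \<Rightarrow> nat \<Rightarrow> (nat \<times> nat) set" where
  "rect_pos m n = {(r, s). 1 \<le> r \<and> r < m \<and> 1 \<le> s \<and> s < n}"

type_synonym ('v, 'k) mtensor = "(nat \<times> nat, 'v, 'k) tensor"

definition TS :: "('k::field \<Rightarrow> 'v::ab_group_add \<Rightarrow> 'v) \<Rightarrow> nat \<Rightarrow> ('v, 'k) mtensor set" where
  "TS scale m = tensor_power scale (tri_pos m)"

definition BV :: "('k::field \<Rightarrow> 'v::ab_group_add \<Rightarrow> 'v) \<Rightarrow> nat \<Rightarrow> nat \<Rightarrow> ('v, 'k) mtensor set" where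
  "BV scale m n = tensor_power scale (rect_pos m n)"

definition tensor_transpose ::
  "('k::field \<Rightarrow> 'v::ab_group_add \<Rightarrow> 'v) \<Rightarrow> nat \<Rightarrow> nat \<Rightarrow> ('v, 'k) mtensor \<Rightarrow> ('v, 'k) mtensor" where
  "tensor_transpose scale m n A =
     (\<lambda>\<phi>. if multilinear_on scale (rect_pos n m) \<phi> then A (\<lambda>w. \<phi> (\<lambda>(s, r). w (r, s))) else 0)"

text \<open>
  \<open>glue n i u w v\<close> is the matrix of entries of the composition at \<open>i\<close>: the indices
  \<open>i, \<dots>, i + n - 2\<close> are new, the others are old.
\<close>

definition new_index :: "nat \<Rightarrow> nat \<Rightarrow> nat \<Rightarrow> bool" where
  "new_index n i t \<longleftrightarrow> i \<le> t \<and> t + 2 \<le> i + n"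

definition old_pos :: "nat \<Rightarrow> nat \<Rightarrow> nat \<Rightarrow> nat" where
  "old_pos n i p = (if p < i then p else p - (n - 1))"

definition glue ::
  "nat \<Rightarrow> nat \<Rightarrow> (nat \<times> nat \<Rightarrow> 'v) \<Rightarrow> (nat \<times> nat \<Rightarrow> 'v) \<Rightarrow> (nat \<times> nat \<Rightarrow> 'v) \<Rightarrow> nat \<times> nat \<Rightarrow> 'v" where
  "glue n i u w v = (\<lambda>(p, q).
     if new_index n i p then
       if new_index n i q then v (p - i + 1, q - i + 1) else w (old_pos n i q, p - i + 1)
     else
       if new_index n i q then w (old_pos n i p, q - i + 1) else u (old_pos n i p, old_pos n i q))"

text \<open>
  The trilinear operation with value \<open>glue n i u w v\<close> on the simple tensors of \<open>u\<close>, \<open>w\<close>, \<open>v\<close>; see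
  \<open>diamond_simple_tensor\<close>.
\<close>

definition diamond ::
  "('k::field \<Rightarrow> 'v::ab_group_add \<Rightarrow> 'v) \<Rightarrow> nat \<Rightarrow> nat \<Rightarrow> nat \<Rightarrow>
     ('v, 'k) mtensor \<Rightarrow> ('v, 'k) mtensor \<Rightarrow> ('v, 'k) mtensor \<Rightarrow> ('v, 'k) mtensor" where
  "diamond scale m n i x A y =
     (\<lambda>\<phi>. if multilinear_on scale (tri_pos (m + n - 1)) \<phi>
          then x (\<lambda>u. A (\<lambda>w. y (\<lambda>v. \<phi> (glue n i u w v)))) else 0)"

section \<open>Ideals and the exterior GSC-operad\<close>

definition gsc_ideal ::
  "('k::field \<Rightarrow> 'v::ab_group_add \<Rightarrow> 'v) \<Rightarrow> (nat \<Rightarrow> ('v, 'k) mtensor set) \<Rightarrow> bool" where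
  "gsc_ideal scale I \<longleftrightarrow>
     (\<forall>m\<ge>1. fun_vs.subspace (I m) \<and> I m \<subseteq> TS scale m) \<and>
     (\<forall>m\<ge>1. \<forall>n\<ge>1. \<forall>x\<in>I m. \<forall>y\<in>TS scale n. \<forall>A\<in>BV scale m n.
        (\<forall>i\<in>{1..m}. diamond scale m n i x A y \<in> I (m + n - 1)) \<and>
        (\<forall>i\<in>{1..n}. diamond scale n m i y (tensor_transpose scale m n A) x \<in> I (m + n - 1)))"

definition gsc_ideal_generated ::
  "('k::field \<Rightarrow> 'v::ab_group_add \<Rightarrow> 'v) \<Rightarrow> (nat \<Rightarrow> ('v, 'k) mtensor set) \<Rightarrow>
     nat \<Rightarrow> ('v, 'k) mtensor set" where
  "gsc_ideal_generated scale G m =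
     \<Inter>{I m | I. gsc_ideal scale I \<and> (\<forall>l\<ge>1. G l \<subseteq> I l)}"

text \<open>
  An upper triangular matrix with unit diagonal is given by the lists of the entries strictly to
  the right of the diagonal, row by row (the last, empty row is omitted).
\<close>

definition upper_matrix :: "'v list list \<Rightarrow> nat \<times> nat \<Rightarrow> 'v" where
  "upper_matrix us = (\<lambda>(p, q). us ! (p - 1) ! (q - p - 1))"

definition upper_tensor ::
  "('k::field \<Rightarrow> 'v::ab_group_add \<Rightarrow> 'v) \<Rightarrow> nat \<Rightarrow> 'v list list \<Rightarrow> ('v, 'k) mtensor" where
  "upper_tensor scale m us = simple_tensor scale (tri_pos m) (upper_matrix us)"

definition ext_generators ::
  "('k::field \<Rightarrow> 'v::ab_group_add \<Rightarrow> 'v) \<Rightarrow> nat \<Rightarrow> ('v, 'k) mtensor set" where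
  "ext_generators scale m = (if m = 4 then range (\<lambda>v. upper_tensor scale 4 [[v, v], [v]]) else {})"

definition ES :: "('k::field \<Rightarrow> 'v::ab_group_add \<Rightarrow> 'v) \<Rightarrow> nat \<Rightarrow> ('v, 'k) mtensor set" where
  "ES scale = gsc_ideal_generated scale (ext_generators scale)"

text \<open>
  The quotient of a subspace \<open>W\<close> of a function space by a subspace \<open>U\<close> of \<open>W\<close>. The fields \<open>mult\<close>
  and \<open>one\<close> of a module record carry no meaning.
\<close>

definition fcoset :: "('x \<Rightarrow> 'k::field) set \<Rightarrow> ('x \<Rightarrow> 'k) \<Rightarrow> ('x \<Rightarrow> 'k) set" where
  "fcoset U x = {x + u | u. u \<in> U}"

definition quotient_space ::
  "('x \<Rightarrow> 'k::field) set \<Rightarrow> ('x \<Rightarrow> 'k) set \<Rightarrow> ('k, ('x \<Rightarrow> 'k) set) module" where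
  "quotient_space W U =
     \<lparr>carrier = fcoset U ` W, mult = undefined, one = undefined, zero = U,
      add = (\<lambda>X Y. {x + y | x y. x \<in> X \<and> y \<in> Y}),
      smult = (\<lambda>c X. {fscale c x + u | x u. x \<in> X \<and> u \<in> U})\<rparr>"

definition Lam ::
  "('k::field \<Rightarrow> 'v::ab_group_add \<Rightarrow> 'v) \<Rightarrow> nat \<Rightarrow> ('k, ('v, 'k) mtensor set) module" where
  "Lam scale m = quotient_space (TS scale m) (ES scale m)"

definition wedge ::
  "('k::field \<Rightarrow> 'v::ab_group_add \<Rightarrow> 'v) \<Rightarrow> nat \<Rightarrow> 'v list list \<Rightarrow> ('v, 'k) mtensor set" where
  "wedge scale m us = fcoset (ES scale m) (upper_tensor scale m us)"

definition Lam_basis ::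
  "('k::field \<Rightarrow> 'v::ab_group_add \<Rightarrow> 'v) \<Rightarrow> nat \<Rightarrow> ('v, 'k) mtensor set list \<Rightarrow> bool" where
  "Lam_basis scale m Bs \<longleftrightarrow>
     distinct Bs \<and> vectorspace.basis class_ring (Lam scale m) (set Bs)"

section \<open>Basic properties\<close>

lemma fscale_apply: "fscale c x z = c * x z"
  by (simp add: fscale_def)

lemma multilinear_onD:
  assumes "multilinear_on scale S \<phi>" "s \<in> S"
  shows "\<phi> (f(s := x + y)) = \<phi> (f(s := x)) + \<phi> (f(s := y))"
    and "\<phi> (f(s := scale c x)) = c * \<phi> (f(s := x))"
  using assms by (auto simp: multilinear_on_def Vector_Spaces.linear_iff)

lemma multilinear_on_cong:
  "multilinear_on scale S \<phi> \<Longrightarrow> (\<And>s. s \<in> S \<Longrightarrow> f s = g s) \<Longrightarrow> \<phi> f = \<phi> g"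
  by (auto simp: multilinear_on_def)

lemma vector_space_mult: "vector_space ((*) :: 'k::field \<Rightarrow> 'k \<Rightarrow> 'k)"
  by unfold_locales (auto simp: algebra_simps)

lemma multilinear_onI:
  assumes "vector_space scale"
    and "\<And>f s x y. s \<in> S \<Longrightarrow> \<phi> (f(s := x + y)) = \<phi> (f(s := x)) + \<phi> (f(s := y))"
    and "\<And>f s c x. s \<in> S \<Longrightarrow> \<phi> (f(s := scale c x)) = c * \<phi> (f(s := x))"
    and "\<And>f g. (\<And>s. s \<in> S \<Longrightarrow> f s = g s) \<Longrightarrow> \<phi> f = \<phi> g"
  shows "multilinear_on scale S \<phi>"
  unfolding multilinear_on_def Vector_Spaces.linear_iff
  using assms vector_space_mult by blast

lemma simple_tensor_cong:
  assumes "\<And>s. s \<in> S \<Longrightarrow> f s = g s"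
  shows "simple_tensor scale S f = simple_tensor scale S g"
  using multilinear_on_cong[OF _ assms] by (fastforce simp: simple_tensor_def)

lemma simple_tensor_in_power [simp]: "simple_tensor scale S f \<in> tensor_power scale S"
  by (simp add: tensor_power_def fun_vs.span_base)

lemma multilinear_simple_tensor:
  assumes "vector_space scale" "s \<in> S"
  shows "Vector_Spaces.linear scale fscale (\<lambda>x. simple_tensor scale S (f(s := x)))"
  using assms fun_vs.vector_space_axioms
  by (auto simp: Vector_Spaces.linear_iff simple_tensor_def fscale_def fun_eq_iff multilinear_onD)

text \<open>A multilinear map into any vector space factors uniquely through the tensor power.\<close>

lemma tensor_power_universal:
  fixes scale :: "'k::field \<Rightarrow> 'v::ab_group_add \<Rightarrow> 'v" and scaleW :: "'k \<Rightarrow> 'w::ab_group_add \<Rightarrow> 'w"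
    and F :: "('i \<Rightarrow> 'v) \<Rightarrow> 'w"
  assumes V: "vector_space scale" and W: "vector_space scaleW"
    and lin: "\<And>f s. s \<in> S \<Longrightarrow> Vector_Spaces.linear scale scaleW (\<lambda>x. F (f(s := x)))"
    and ext: "\<And>f g. (\<And>s. s \<in> S \<Longrightarrow> f s = g s) \<Longrightarrow> F f = F g"
  shows "\<exists>h. Vector_Spaces.linear fscale scaleW h \<and> (\<forall>f. h (simple_tensor scale S f) = F f)"
    and "\<lbrakk>Vector_Spaces.linear fscale scaleW h; Vector_Spaces.linear fscale scaleW h';
          \<And>f. h (simple_tensor scale S f) = F f; \<And>f. h' (simple_tensor scale S f) = F f;
          x \<in> tensor_power scale S\<rbrakk> \<Longrightarrow> h x = h' x"
proof -
  interpret V: vector_space scale by fact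
  interpret W: vector_space scaleW by fact
  interpret P: vector_space_pair fscale scaleW ..
  interpret k: vector_space "(*) :: 'k \<Rightarrow> 'k \<Rightarrow> 'k" by (rule vector_space_mult)
  interpret Wk: vector_space_pair scaleW "(*) :: 'k \<Rightarrow> 'k \<Rightarrow> 'k" ..
  let ?st = "simple_tensor scale S"
  show "\<exists>h. Vector_Spaces.linear fscale scaleW h \<and> (\<forall>f. h (?st f) = F f)"
  proof -
    obtain B where B: "B \<subseteq> range ?st" "fun_vs.independent B" "range ?st \<subseteq> fun_vs.span B"
      using fun_vs.maximal_independent_subset by blast
    define g where "g = (\<lambda>b. SOME f. ?st f = b)"
    have g: "?st (g b) = b" if "b \<in> B" for b
    proof -
      from that B(1) have "\<exists>f. ?st f = b" by auto
      then show ?thesis unfolding g_def by (rule someI_ex)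
    qed
    obtain h where h: "Vector_Spaces.linear fscale scaleW h" "\<forall>b\<in>B. h b = F (g b)"
      using P.linear_independent_extend[OF B(2), of "\<lambda>b. F (g b)"] by blast
    interpret h: Vector_Spaces.linear fscale scaleW h by (rule h(1))
    have "h (?st f) = F f" for f
    proof (rule ccontr)
      assume ne: "h (?st f) \<noteq> F f"
      have "?st f \<in> fun_vs.span B" using B(3) by auto
      then obtain T r where T: "finite T" "T \<subseteq> B" "?st f = (\<Sum>b\<in>T. fscale (r b) b)"
        unfolding fun_vs.span_explicit by blast
      define w where "w = h (?st f) - F f"
      have "w \<noteq> 0" using ne by (simp add: w_def)
      then have "W.independent {w}" by simp
      then obtain l where l: "Vector_Spaces.linear scaleW (*) l" "\<forall>x\<in>{w}. l x = (1::'k)"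
        using Wk.linear_independent_extend[of "{w}" "\<lambda>_. 1"] by blast
      interpret l: Vector_Spaces.linear scaleW "(*)" l by (rule l(1))
      have m: "multilinear_on scale S (\<lambda>f. l (F f))"
        unfolding multilinear_on_def
      proof (intro conjI allI ballI impI)
        fix f s assume "s \<in> S"
        from Vector_Spaces.linear_compose[OF lin[OF this] l(1)]
        show "Vector_Spaces.linear scale (*) (\<lambda>x. l (F (f(s := x))))" by (simp add: o_def)
      next
        fix f f' :: "'i \<Rightarrow> 'v" assume "\<forall>s\<in>S. f s = f' s"
        then show "l (F f) = l (F f')" using ext[of f f'] by simp
      qed
      have hs: "h (?st f) = (\<Sum>b\<in>T. scaleW (r b) (F (g b)))"
        unfolding T(3) h.sum using T(2) h(2) by (auto simp: h.scale intro!: sum.cong)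
      have "l (F f) = ?st f (\<lambda>f. l (F f))" using m by (simp add: simple_tensor_def)
      also have "\<dots> = (\<Sum>b\<in>T. r b * b (\<lambda>f. l (F f)))"
        unfolding T(3) using T(1) by (induction T rule: finite_induct) (auto simp: fscale_def)
      also have "\<dots> = (\<Sum>b\<in>T. r b * l (F (g b)))"
      proof (rule sum.cong)
        fix b assume "b \<in> T"
        then have "b = ?st (g b)" using T(2) g by auto
        then have "b (\<lambda>f. l (F f)) = l (F (g b))" using m by (metis (mono_tags, lifting) simple_tensor_def)
        then show "r b * b (\<lambda>f. l (F f)) = r b * l (F (g b))" by simp
      qed simp
      also have "\<dots> = l (h (?st f))" unfolding hs l.sum by (simp add: l.scale)
      finally have "l w = 0" by (simp add: w_def l.diff)
      with l(2) show False by simp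
    qed
    with h(1) show ?thesis by blast
  qed
  show "h x = h' x"
    if "Vector_Spaces.linear fscale scaleW h" "Vector_Spaces.linear fscale scaleW h'"
      "\<And>f. h (?st f) = F f" "\<And>f. h' (?st f) = F f" "x \<in> tensor_power scale S"
  proof (rule P.linear_eq_on[OF that(1,2)])
    show "x \<in> fun_vs.span (range ?st)" using that(5) by (simp add: tensor_power_def)
    show "h b = h' b" if "b \<in> range ?st" for b
      using that \<open>\<And>f. h (?st f) = F f\<close> \<open>\<And>f. h' (?st f) = F f\<close> by auto
  qed
qed

lemma multilinear_on_add:
  "multilinear_on scale S \<phi> \<Longrightarrow> multilinear_on scale S \<psi> \<Longrightarrow> multilinear_on scale S (\<lambda>f. \<phi> f + \<psi> f)"
  unfolding multilinear_on_def Vector_Spaces.linear_iff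
  by (auto simp: algebra_simps) metis

lemma multilinear_on_scale:
  "multilinear_on scale S \<phi> \<Longrightarrow> multilinear_on scale S (\<lambda>f. c * \<phi> f)"
  unfolding multilinear_on_def Vector_Spaces.linear_iff
  by (auto simp: algebra_simps)

lemma tensor_power_closed:
  "0 \<in> tensor_power scale S"
  "a \<in> tensor_power scale S \<Longrightarrow> b \<in> tensor_power scale S \<Longrightarrow> a + b \<in> tensor_power scale S"
  "a \<in> tensor_power scale S \<Longrightarrow> fscale c a \<in> tensor_power scale S"
  by (simp_all add: tensor_power_def fun_vs.span_zero fun_vs.span_add fun_vs.span_scale)

lemma tensor_power_induct [consumes 1, case_names zero step]:
  assumes "x \<in> tensor_power scale S" "P 0"
    and step: "\<And>c f z. z \<in> tensor_power scale S \<Longrightarrow> P z \<Longrightarrow>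
      P (fscale c (simple_tensor scale S f) + z)"
  shows "P x"
proof -
  have "x \<in> tensor_power scale S \<and> P x"
    using assms(1) unfolding tensor_power_def
  proof (induction x rule: fun_vs.span_induct_alt)
    case base
    show ?case using assms(2) fun_vs.span_zero by blast
  next
    case (step c b z)
    then obtain f where b: "b = simple_tensor scale S f" by auto
    have "fscale c b + z \<in> fun_vs.span (range (simple_tensor scale S))"
      using step by (auto intro: fun_vs.span_add fun_vs.span_scale fun_vs.span_base)
    moreover have "P (fscale c b + z)"
      unfolding b using step by (intro assms(3)) (auto simp: tensor_power_def)
    ultimately show ?case by (rule conjI)
  qed
  then show ?thesis ..
qed

lemma tensor_power_off: "x \<in> tensor_power scale S \<Longrightarrow> \<not> multilinear_on scale S \<phi> \<Longrightarrow> x \<phi> = 0"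
  unfolding tensor_power_def
  by (induction x rule: fun_vs.span_induct_alt) (auto simp: simple_tensor_def fscale_def)

lemma tensor_power_additive:
  "x \<in> tensor_power scale S \<Longrightarrow> multilinear_on scale S \<phi> \<Longrightarrow> multilinear_on scale S \<psi> \<Longrightarrow>
    x (\<lambda>f. \<phi> f + \<psi> f) = x \<phi> + x \<psi>"
  unfolding tensor_power_def
  by (induction x rule: fun_vs.span_induct_alt)
    (auto simp: simple_tensor_def fscale_def multilinear_on_add algebra_simps)

lemma tensor_power_homogeneous:
  "x \<in> tensor_power scale S \<Longrightarrow> multilinear_on scale S \<phi> \<Longrightarrow> x (\<lambda>f. c * \<phi> f) = c * x \<phi>"
  unfolding tensor_power_def
  by (induction x rule: fun_vs.span_induct_alt)
    (auto simp: simple_tensor_def fscale_def multilinear_on_scale algebra_simps)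

lemma multilinear_on_tensor_power:
  fixes scale :: "'k::field \<Rightarrow> 'v::ab_group_add \<Rightarrow> 'v" and A :: "('i, 'v, 'k) tensor"
    and \<Psi> :: "('j \<Rightarrow> 'v) \<Rightarrow> ('i \<Rightarrow> 'v) \<Rightarrow> 'k"
  assumes "vector_space scale" "A \<in> tensor_power scale S"
    and 1: "\<And>u. multilinear_on scale S (\<Psi> u)"
    and 2: "\<And>w. multilinear_on scale S' (\<lambda>u. \<Psi> u w)"
  shows "multilinear_on scale S' (\<lambda>u. A (\<Psi> u))"
proof (rule multilinear_onI)
  fix f s x y assume s: "s \<in> S'"
  have "\<Psi> (f(s := x + y)) = (\<lambda>w. \<Psi> (f(s := x)) w + \<Psi> (f(s := y)) w)"
    using multilinear_onD(1)[OF 2 s] by auto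
  then show "A (\<Psi> (f(s := x + y))) = A (\<Psi> (f(s := x))) + A (\<Psi> (f(s := y)))"
    using tensor_power_additive[OF assms(2) 1 1] by simp
next
  fix f s c x assume s: "s \<in> S'"
  have "\<Psi> (f(s := scale c x)) = (\<lambda>w. c * \<Psi> (f(s := x)) w)"
    using multilinear_onD(2)[OF 2 s] by auto
  then show "A (\<Psi> (f(s := scale c x))) = c * A (\<Psi> (f(s := x)))"
    using tensor_power_homogeneous[OF assms(2) 1] by simp
next
  fix f g :: "'j \<Rightarrow> 'v" assume "\<And>s. s \<in> S' \<Longrightarrow> f s = g s"
  then have "\<Psi> f = \<Psi> g" using multilinear_on_cong[OF 2] by blast
  then show "A (\<Psi> f) = A (\<Psi> g)" by simp
qed fact

lemma multilinear_on_reindex: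
  fixes scale :: "'k::field \<Rightarrow> 'v::ab_group_add \<Rightarrow> 'v"
    and G :: "('j \<Rightarrow> 'v) \<Rightarrow> 'i \<Rightarrow> 'v"
  assumes "vector_space scale" "multilinear_on scale S \<phi>" "bij_betw \<kappa> (D \<inter> S) S'"
    and G: "\<And>f j. j \<in> S \<Longrightarrow> G f j = (if j \<in> D then f (\<kappa> j) else c j)"
  shows "multilinear_on scale S' (\<lambda>f. \<phi> (G f))"
proof -
  have upd: "\<exists>j\<in>S. \<forall>f x. \<phi> (G (f(s := x))) = \<phi> ((G f)(j := x))" if s: "s \<in> S'" for s
  proof -
    from s assms(3) obtain j where j: "j \<in> D" "j \<in> S" "s = \<kappa> j" by (auto simp: bij_betw_def)
    have "\<phi> (G (f(s := x))) = \<phi> ((G f)(j := x))" for f x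
    proof (rule multilinear_on_cong[OF assms(2)])
      fix j' assume "j' \<in> S"
      then show "G (f(s := x)) j' = ((G f)(j := x)) j'"
        using j assms(3) by (auto simp: G bij_betw_def inj_on_def)
    qed
    with j show ?thesis by blast
  qed
  show ?thesis
  proof (rule multilinear_onI)
    fix f s x y assume "s \<in> S'"
    from upd[OF this] show "\<phi> (G (f(s := x + y))) = \<phi> (G (f(s := x))) + \<phi> (G (f(s := y)))"
      by (auto simp: multilinear_onD[OF assms(2)])
  next
    fix f s c x assume "s \<in> S'"
    from upd[OF this] show "\<phi> (G (f(s := scale c x))) = c * \<phi> (G (f(s := x)))"
      by (auto simp: multilinear_onD[OF assms(2)])
  next
    fix f g :: "'j \<Rightarrow> 'v" assume "\<And>s. s \<in> S' \<Longrightarrow> f s = g s"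
    then show "\<phi> (G f) = \<phi> (G g)"
      using assms(3) by (intro multilinear_on_cong[OF assms(2)]) (auto simp: G bij_betw_def)
  qed fact
qed

context
  fixes m n i :: nat
  assumes mn: "1 \<le> m" "1 \<le> n" "1 \<le> i" "i \<le> m"
begin

lemma bij_mixed_pos:
  "bij_betw (\<lambda>(p, q). if new_index n i p then (old_pos n i q, p - i + 1) else (old_pos n i p, q - i + 1))
   ({(p, q). new_index n i p \<noteq> new_index n i q} \<inter> tri_pos (m + n - 1)) (rect_pos m n)"
proof -
  define g where "g t = (if t < i then t else t + n - 1)" for t
  have g: "g (old_pos n i p) = p" if "\<not> new_index n i p" for p
    using that mn by (auto simp: g_def new_index_def old_pos_def)
  have o: "old_pos n i (g t) = t" "\<not> new_index n i (g t)" "1 \<le> g t" if "1 \<le> t" for t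
    using that mn by (auto simp: g_def new_index_def old_pos_def)
  have lt: "g t < m + n - 1" if "t < m" for t
    using that mn by (auto simp: g_def)
  have op: "1 \<le> old_pos n i p" "p < m + n - 1 \<Longrightarrow> old_pos n i p < m" if "\<not> new_index n i p" "1 \<le> p" for p
    using that mn by (auto simp: new_index_def old_pos_def)
  have nw: "new_index n i (s + i - 1)" "s + i - 1 < m + n - 1" "1 \<le> s + i - 1" "(s + i - 1) - i + 1 = s"
    if "1 \<le> s" "s < n" for s using that mn by (auto simp: new_index_def)
  have nv: "1 \<le> p - i + 1" "p - i + 1 < n" "(p - i + 1) + i - 1 = p" if "new_index n i p" for p
    using that mn by (auto simp: new_index_def)
  have lts: "s + i - 1 < g t \<longleftrightarrow> i \<le> t" if "1 \<le> s" "s < n" for s t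
    using that mn by (auto simp: g_def)
  have gts: "g t < s + i - 1" if "1 \<le> s" "s < n" "t < i" for s t
    using that mn by (auto simp: g_def)
  have oi: "i \<le> old_pos n i q" if "new_index n i p" "\<not> new_index n i q" "p < q" for p q
    using that mn by (auto simp: new_index_def old_pos_def)
  have oj: "old_pos n i p < i" if "\<not> new_index n i p" "new_index n i q" "p < q" for p q
    using that mn by (auto simp: new_index_def old_pos_def)
  show ?thesis
  proof (rule bij_betw_byWitness[where f' = "\<lambda>(r, s). if r < i then (g r, s + i - 1) else (s + i - 1, g r)"],
    goal_cases)
    case 1
    have "(if old_pos n i q < i then (g (old_pos n i q), p - i + 1 + i - 1)
        else (p - i + 1 + i - 1, g (old_pos n i q))) = (p, q)"
      if "new_index n i p" "\<not> new_index n i q" "p < q" for p q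
      using oi[OF that] g[OF that(2)] nv(3)[OF that(1)] by simp
    moreover have "(if old_pos n i p < i then (g (old_pos n i p), q - i + 1 + i - 1)
        else (q - i + 1 + i - 1, g (old_pos n i p))) = (p, q)"
      if "\<not> new_index n i p" "new_index n i q" "p < q" for p q
      using oj[OF that] g[OF that(1)] nv(3)[OF that(2)] by simp
    ultimately show ?case by (auto simp del: One_nat_def simp: tri_pos_def)
  next
    case 2 show ?case
      using o nw by (auto simp: rect_pos_def)
  next
    case 3
    have "(old_pos n i q, p - i + 1) \<in> rect_pos m n"
      if "new_index n i p" "\<not> new_index n i q" "1 \<le> q" "q < m + n - 1" for p q
      using op(1)[OF that(2,3)] op(2)[OF that(2-4)] nv(1,2)[OF that(1)] by (simp add: rect_pos_def)
    note new_old = this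
    show ?case
    proof (rule image_subsetI)
      fix z assume "z \<in> {(p, q). new_index n i p \<noteq> new_index n i q} \<inter> tri_pos (m + n - 1)"
      moreover obtain p q where "z = (p, q)" by (cases z)
      ultimately have z: "z = (p, q)" "new_index n i p \<noteq> new_index n i q"
        "1 \<le> p" "1 \<le> q" "p < m + n - 1" "q < m + n - 1"
        unfolding tri_pos_def by simp_all
      show "(case z of (p, q) \<Rightarrow> if new_index n i p then (old_pos n i q, p - i + 1)
          else (old_pos n i p, q - i + 1)) \<in> rect_pos m n"
        using z(2) new_old[OF _ _ z(4,6)] new_old[OF _ _ z(3,5)]
        by (cases "new_index n i p") (simp_all add: z(1))
    qed
  next
    case 4
    have old_1: "(g r, s + i - 1) \<in> {(p, q). new_index n i p \<noteq> new_index n i q} \<inter> tri_pos (m + n - 1)"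
      if "r < i" "1 \<le> r" "r < m" "1 \<le> s" "s < n" for r s
      using o(2,3)[OF that(2)] nw(1-3)[OF that(4,5)] gts[OF that(4,5,1)] by (simp add: tri_pos_def)
    have old_2: "(s + i - 1, g r) \<in> {(p, q). new_index n i p \<noteq> new_index n i q} \<inter> tri_pos (m + n - 1)"
      if "\<not> r < i" "1 \<le> r" "r < m" "1 \<le> s" "s < n" for r s
      using o(2,3)[OF that(2)] nw(1-3)[OF that(4,5)] lts[OF that(4,5), of r] lt[OF that(3)] that(1)
      by (simp add: tri_pos_def)
    show ?case
    proof (rule image_subsetI)
      fix z assume "z \<in> rect_pos m n"
      moreover obtain r s where "z = (r, s)" by (cases z)
      ultimately have z: "z = (r, s)" "1 \<le> r" "r < m" "1 \<le> s" "s < n"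
        unfolding rect_pos_def by simp_all
      show "(case z of (r, s) \<Rightarrow> if r < i then (g r, s + i - 1) else (s + i - 1, g r)) \<in>
          {(p, q). new_index n i p \<noteq> new_index n i q} \<inter> tri_pos (m + n - 1)"
        using old_1[OF _ z(2-5)] old_2[OF _ z(2-5)]
        by (cases "r < i") (simp_all add: z(1))
    qed
  qed
qed
lemma bij_old_pos:
  "bij_betw (\<lambda>(p, q). (old_pos n i p, old_pos n i q))
   ({(p, q). \<not> new_index n i p \<and> \<not> new_index n i q} \<inter> tri_pos (m + n - 1)) (tri_pos m)"
proof -
  define g where "g t = (if t < i then t else t + n - 1)" for t
  have g: "g (old_pos n i p) = p" if "\<not> new_index n i p" for p
    using that mn by (auto simp: g_def new_index_def old_pos_def)
  have o: "old_pos n i (g t) = t" "\<not> new_index n i (g t)" "1 \<le> g t" if "1 \<le> t" for t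
    using that mn by (auto simp: g_def new_index_def old_pos_def)
  have lt: "g t < m + n - 1" if "t < m" for t
    using that mn by (auto simp: g_def)
  have op: "1 \<le> old_pos n i p" "p < m + n - 1 \<Longrightarrow> old_pos n i p < m" if "\<not> new_index n i p" "1 \<le> p" for p
    using that mn by (auto simp: new_index_def old_pos_def)
  have mono: "g s < g t" if "s < t" for s t using that mn by (auto simp: g_def)
  have mono': "old_pos n i s < old_pos n i t" if "s < t" "\<not> new_index n i s" "\<not> new_index n i t" for s t
    using that mn by (auto simp: new_index_def old_pos_def)
  show ?thesis
  proof (rule bij_betw_byWitness[where f' = "\<lambda>(r, s). (g r, g s)"], goal_cases)
    case 1 show ?case by (auto simp: g)
  next
    case 2 show ?case by (auto simp: tri_pos_def o)
  next
    case 3 show ?case using op mono' by (auto simp: tri_pos_def)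
  next
    case 4 show ?case using o(2,3) lt mono by (force simp: tri_pos_def)
  qed
qed
lemma bij_new_pos:
  "bij_betw (\<lambda>(p, q). (p - i + 1, q - i + 1))
     ({(p, q). new_index n i p \<and> new_index n i q} \<inter> tri_pos (m + n - 1)) (tri_pos n)"
  by (rule bij_betw_byWitness[where f' = "\<lambda>(p, q). (p + i - 1, q + i - 1)"])
    (use mn in \<open>auto simp: tri_pos_def new_index_def\<close>)

lemma multilinear_glue_new:
  assumes "vector_space scale" "multilinear_on scale (tri_pos (m + n - 1)) \<phi>"
  shows "multilinear_on scale (tri_pos n) (\<lambda>v. \<phi> (glue n i u w v))"
proof (rule multilinear_on_reindex[OF assms bij_new_pos,
      where G = "\<lambda>v. glue n i u w v" and c = "glue n i u w undefined"])
  show "glue n i u w v j = (if j \<in> {(p, q). new_index n i p \<and> new_index n i q}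
      then v ((
        \<lambda>(p, q). (p - i + 1, q - i + 1)) j)
      else glue n i u w undefined j)" for v j
    by (cases j; cases "new_index n i (fst j)"; cases "new_index n i (snd j)") (simp_all add: glue_def)
qed

lemma multilinear_glue_mixed:
  assumes "vector_space scale" "multilinear_on scale (tri_pos (m + n - 1)) \<phi>"
  shows "multilinear_on scale (rect_pos m n) (\<lambda>w. \<phi> (glue n i u w v))"
proof (rule multilinear_on_reindex[OF assms bij_mixed_pos,
      where G = "\<lambda>w. glue n i u w v" and c = "glue n i u undefined v"])
  show "glue n i u w v j = (if j \<in> {(p, q). new_index n i p \<noteq> new_index n i q}
      then w ((
        \<lambda>(p, q). if new_index n i p then (old_pos n i q, p - i + 1) else (old_pos n i p, q - i + 1)) j)
      else glue n i u undefined v j)" for w j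
    by (cases j; cases "new_index n i (fst j)"; cases "new_index n i (snd j)") (simp_all add: glue_def)
qed

lemma multilinear_glue_old:
  assumes "vector_space scale" "multilinear_on scale (tri_pos (m + n - 1)) \<phi>"
  shows "multilinear_on scale (tri_pos m) (\<lambda>u. \<phi> (glue n i u w v))"
proof (rule multilinear_on_reindex[OF assms bij_old_pos,
      where G = "\<lambda>u. glue n i u w v" and c = "glue n i undefined w v"])
  show "glue n i u w v j = (if j \<in> {(p, q). \<not> new_index n i p \<and> \<not> new_index n i q}
      then u ((
        \<lambda>(p, q). (old_pos n i p, old_pos n i q)) j)
      else glue n i undefined w v j)" for u j
    by (cases j; cases "new_index n i (fst j)"; cases "new_index n i (snd j)") (simp_all add: glue_def)
qed

lemma diamond_simple_tensor:
  assumes "vector_space scale"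
  shows "diamond scale m n i (simple_tensor scale (tri_pos m) u)
           (simple_tensor scale (rect_pos m n) w) (simple_tensor scale (tri_pos n) v) =
         simple_tensor scale (tri_pos (m + n - 1)) (glue n i u w v)"
proof
  fix \<phi>
  show "diamond scale m n i (simple_tensor scale (tri_pos m) u)
      (simple_tensor scale (rect_pos m n) w) (simple_tensor scale (tri_pos n) v) \<phi> =
    simple_tensor scale (tri_pos (m + n - 1)) (glue n i u w v) \<phi>"
  proof (cases "multilinear_on scale (tri_pos (m + n - 1)) \<phi>")
    case True
    show ?thesis
      by (simp add: diamond_def simple_tensor_def True multilinear_glue_new[OF assms True]
        multilinear_glue_mixed[OF assms True] multilinear_glue_old[OF assms True])
  qed (simp add: diamond_def simple_tensor_def)
qed

lemma multilinear_glue_tensor: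
  assumes "vector_space scale" "multilinear_on scale (tri_pos (m + n - 1)) \<phi>"
    and "A \<in> BV scale m n" "y \<in> TS scale n"
  shows "multilinear_on scale (rect_pos m n) (\<lambda>w. y (\<lambda>v. \<phi> (glue n i u w v)))"
    and "multilinear_on scale (tri_pos m) (\<lambda>u. y (\<lambda>v. \<phi> (glue n i u w v)))"
    and "multilinear_on scale (tri_pos m) (\<lambda>u. A (\<lambda>w. y (\<lambda>v. \<phi> (glue n i u w v))))"
proof -
  note y = assms(4)[unfolded TS_def] and A = assms(3)[unfolded BV_def]
  show 1: "multilinear_on scale (rect_pos m n) (\<lambda>w. y (\<lambda>v. \<phi> (glue n i u w v)))" for u
    by (rule multilinear_on_tensor_power[OF assms(1) y, where \<Psi> = "\<lambda>w v. \<phi> (glue n i u w v)"])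
      (rule multilinear_glue_new[OF assms(1,2)] multilinear_glue_mixed[OF assms(1,2)])+
  show 2: "multilinear_on scale (tri_pos m) (\<lambda>u. y (\<lambda>v. \<phi> (glue n i u w v)))" for w
    by (rule multilinear_on_tensor_power[OF assms(1) y, where \<Psi> = "\<lambda>u v. \<phi> (glue n i u w v)"])
      (rule multilinear_glue_new[OF assms(1,2)] multilinear_glue_old[OF assms(1,2)])+
  show "multilinear_on scale (tri_pos m) (\<lambda>u. A (\<lambda>w. y (\<lambda>v. \<phi> (glue n i u w v))))"
    by (rule multilinear_on_tensor_power[OF assms(1) A,
          where \<Psi> = "\<lambda>u w. y (\<lambda>v. \<phi> (glue n i u w v))"]) (rule 1 2)+
qed

lemma diamond_add:
  assumes "vector_space scale"
  shows "diamond scale m n i (x + x') A y = diamond scale m n i x A y + diamond scale m n i x' A y"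
    and "x \<in> TS scale m \<Longrightarrow> A \<in> BV scale m n \<Longrightarrow> A' \<in> BV scale m n \<Longrightarrow> y \<in> TS scale n \<Longrightarrow>
      diamond scale m n i x (A + A') y = diamond scale m n i x A y + diamond scale m n i x A' y"
    and "x \<in> TS scale m \<Longrightarrow> A \<in> BV scale m n \<Longrightarrow> y \<in> TS scale n \<Longrightarrow> y' \<in> TS scale n \<Longrightarrow>
      diamond scale m n i x A (y + y') = diamond scale m n i x A y + diamond scale m n i x A y'"
proof -
  let ?ml = "multilinear_on scale (tri_pos (m + n - 1))"
  show "diamond scale m n i (x + x') A y = diamond scale m n i x A y + diamond scale m n i x' A y"
    by (auto simp: diamond_def fun_eq_iff)
  show "diamond scale m n i x (A + A') y = diamond scale m n i x A y + diamond scale m n i x A' y"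
    if x: "x \<in> TS scale m" and A: "A \<in> BV scale m n" "A' \<in> BV scale m n" and y: "y \<in> TS scale n"
  proof
    fix \<phi>
    show "diamond scale m n i x (A + A') y \<phi> =
      (diamond scale m n i x A y + diamond scale m n i x A' y) \<phi>"
    proof (cases "?ml \<phi>")
      case True
      note ml = multilinear_glue_tensor[OF assms True _ y]
      show ?thesis
        using True tensor_power_additive[OF x[unfolded TS_def] ml(3)[OF A(1)] ml(3)[OF A(2)]]
        by (simp add: diamond_def)
    qed (simp add: diamond_def)
  qed
  show "diamond scale m n i x A (y + y') = diamond scale m n i x A y + diamond scale m n i x A y'"
    if x: "x \<in> TS scale m" and A: "A \<in> BV scale m n" and y: "y \<in> TS scale n" "y' \<in> TS scale n"
  proof
    fix \<phi>
    show "diamond scale m n i x A (y + y') \<phi> =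
      (diamond scale m n i x A y + diamond scale m n i x A y') \<phi>"
    proof (cases "?ml \<phi>")
      case True
      note ml = multilinear_glue_tensor[OF assms True A]
      show ?thesis
        using True tensor_power_additive[OF x[unfolded TS_def] ml(3)[OF y(1)] ml(3)[OF y(2)]]
          tensor_power_additive[OF A[unfolded BV_def] ml(1)[OF y(1)] ml(1)[OF y(2)]]
        by (simp add: diamond_def)
    qed (simp add: diamond_def)
  qed
qed

lemma diamond_scale:
  assumes "vector_space scale"
  shows "diamond scale m n i (fscale c x) A y = fscale c (diamond scale m n i x A y)"
    and "x \<in> TS scale m \<Longrightarrow> A \<in> BV scale m n \<Longrightarrow> y \<in> TS scale n \<Longrightarrow>
      diamond scale m n i x (fscale c A) y = fscale c (diamond scale m n i x A y)"
    and "x \<in> TS scale m \<Longrightarrow> A \<in> BV scale m n \<Longrightarrow> y \<in> TS scale n \<Longrightarrow>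
      diamond scale m n i x A (fscale c y) = fscale c (diamond scale m n i x A y)"
proof -
  let ?ml = "multilinear_on scale (tri_pos (m + n - 1))"
  show "diamond scale m n i (fscale c x) A y = fscale c (diamond scale m n i x A y)"
    by (auto simp: diamond_def fscale_def fun_eq_iff)
  assume x: "x \<in> TS scale m" and A: "A \<in> BV scale m n" and y: "y \<in> TS scale n"
  have *: "diamond scale m n i x (fscale c A) y \<phi> = fscale c (diamond scale m n i x A y) \<phi> \<and>
      diamond scale m n i x A (fscale c y) \<phi> = fscale c (diamond scale m n i x A y) \<phi>" for \<phi>
  proof (cases "?ml \<phi>")
    case True
    note ml = multilinear_glue_tensor[OF assms True A y]
    show ?thesis
      using True tensor_power_homogeneous[OF x[unfolded TS_def] ml(3)]
        tensor_power_homogeneous[OF A[unfolded BV_def] ml(1)]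
      by (simp add: diamond_def fscale_def)
  qed (simp add: diamond_def fscale_def)
  show "diamond scale m n i x (fscale c A) y = fscale c (diamond scale m n i x A y)"
    "diamond scale m n i x A (fscale c y) = fscale c (diamond scale m n i x A y)"
    using * by auto
qed

lemma diamond_in_TS:
  assumes V: "vector_space scale"
    and x: "x \<in> TS scale m" and A: "A \<in> BV scale m n" and y: "y \<in> TS scale n"
  shows "diamond scale m n i x A y \<in> TS scale (m + n - 1)"
proof -
  let ?R = "TS scale (m + n - 1)"
  have R0: "0 \<in> ?R" and R: "a \<in> ?R \<Longrightarrow> b \<in> ?R \<Longrightarrow> fscale c a + b \<in> ?R" for a b c
    by (simp_all add: TS_def tensor_power_closed)
  let ?su = "simple_tensor scale (tri_pos m)"
  let ?sw = "simple_tensor scale (rect_pos m n)"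
  let ?sv = "simple_tensor scale (tri_pos n)"
  have su: "?su u \<in> TS scale m" for u by (simp add: TS_def)
  have sw: "?sw w \<in> BV scale m n" for w by (simp add: BV_def)
  have sv: "?sv v \<in> TS scale n" for v by (simp add: TS_def)
  have y': "diamond scale m n i (?su u) (?sw w) y \<in> ?R" for u w
    using y unfolding TS_def[of scale n]
  proof (induction y rule: tensor_power_induct)
    case zero
    have 0: "diamond scale m n i (?su u) (?sw w) 0 = 0"
      using diamond_scale(3)[OF V su sw sv, where c = 0] by simp
    have "diamond scale m n i (?su u) (?sw w) 0 \<in> ?R" unfolding 0 by (rule R0)
    then show ?case .
  next
    case (step c v z)
    have c: "fscale c (?sv v) \<in> TS scale n" and z: "z \<in> TS scale n"
      using step(1) by (simp_all add: TS_def tensor_power_closed)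
    have "diamond scale m n i (?su u) (?sw w) (?sv v) \<in> ?R"
      unfolding diamond_simple_tensor[OF V] by (simp add: TS_def)
    then show ?case
      unfolding diamond_add(3)[OF V su sw c z] diamond_scale(3)[OF V su sw sv]
      using step(2) by (rule R)
  qed
  have A': "diamond scale m n i (?su u) A y \<in> ?R" for u
    using A unfolding BV_def
  proof (induction A rule: tensor_power_induct)
    case zero
    have 0: "diamond scale m n i (?su u) 0 y = 0"
      using diamond_scale(2)[OF V su sw y, where c = 0] by simp
    have "diamond scale m n i (?su u) 0 y \<in> ?R" unfolding 0 by (rule R0)
    then show ?case .
  next
    case (step c w z)
    have c: "fscale c (?sw w) \<in> BV scale m n" and z: "z \<in> BV scale m n"
      using step(1) by (simp_all add: BV_def tensor_power_closed)
    show ?case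
      unfolding diamond_add(2)[OF V su c z y] diamond_scale(2)[OF V su sw y]
      using y' step(2) by (rule R)
  qed
  show ?thesis
    using x unfolding TS_def[of scale m]
  proof (induction x rule: tensor_power_induct)
    case zero
    have 0: "diamond scale m n i 0 A y = 0"
      using diamond_scale(1)[OF V, where c = 0 and x = 0] by simp
    have "diamond scale m n i 0 A y \<in> ?R" unfolding 0 by (rule R0)
    then show ?case .
  next
    case (step c u z)
    show ?case
      unfolding diamond_add(1)[OF V] diamond_scale(1)[OF V]
      using A' step(2) by (rule R)
  qed
qed

end

lemma multilinear_transpose:
  assumes "vector_space scale" "multilinear_on scale (rect_pos n m) \<phi>"
  shows "multilinear_on scale (rect_pos m n) (\<lambda>w. \<phi> (\<lambda>(s, r). w (r, s)))"
  by (rule multilinear_on_reindex[OF assms, where D = UNIV and \<kappa> = "\<lambda>(s, r). (r, s)"],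
      rule bij_betw_byWitness[where f' = "\<lambda>(s, r). (r, s)"])
    (auto simp: rect_pos_def)

lemma tensor_transpose_simple_tensor:
  assumes "vector_space scale"
  shows "tensor_transpose scale m n (simple_tensor scale (rect_pos m n) w) =
    simple_tensor scale (rect_pos n m) (\<lambda>(s, r). w (r, s))"
  using multilinear_transpose[OF assms]
  by (auto simp: tensor_transpose_def simple_tensor_def fun_eq_iff)

lemma tensor_transpose_linear:
  "tensor_transpose scale m n (A + A') = tensor_transpose scale m n A + tensor_transpose scale m n A'"
  "tensor_transpose scale m n (fscale c A) = fscale c (tensor_transpose scale m n A)"
  by (auto simp: tensor_transpose_def fscale_def fun_eq_iff)

lemma tensor_transpose_in_BV:
  assumes "vector_space scale" "A \<in> BV scale m n"
  shows "tensor_transpose scale m n A \<in> BV scale n m"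
  using assms(2) unfolding BV_def
proof (induction A rule: tensor_power_induct)
  case zero
  have 0: "tensor_transpose scale m n 0 = 0" by (auto simp: tensor_transpose_def fun_eq_iff)
  have "tensor_transpose scale m n 0 \<in> tensor_power scale (rect_pos n m)"
    unfolding 0 by (rule tensor_power_closed(1))
  then show ?case .
next
  case (step c f z)
  have "tensor_transpose scale m n (simple_tensor scale (rect_pos m n) f)
    \<in> tensor_power scale (rect_pos n m)"
    by (simp add: tensor_transpose_simple_tensor[OF assms(1)])
  then show ?case
    unfolding tensor_transpose_linear using step(2)
    by (intro tensor_power_closed)
qed

lemma gsc_ideal_TS:
  assumes "vector_space scale"
  shows "gsc_ideal scale (TS scale)"
  unfolding gsc_ideal_def
proof (intro conjI allI impI ballI)
  fix m n i x y A
  assume *: "1 \<le> m" "1 \<le> n" "x \<in> TS scale m" "y \<in> TS scale n" "A \<in> BV scale m n"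
  show "diamond scale m n i x A y \<in> TS scale (m + n - 1)" if "i \<in> {1..m}"
    using * that by (intro diamond_in_TS assms) auto
  show "diamond scale n m i y (tensor_transpose scale m n A) x \<in> TS scale (m + n - 1)"
    if "i \<in> {1..n}"
    using diamond_in_TS[OF *(2,1) _ _ assms *(4) tensor_transpose_in_BV[OF assms *(5)] *(3), of i] that
    by (auto simp: add.commute)
qed (auto simp: TS_def tensor_power_def)

lemma gsc_ideal_ES:
  assumes V: "vector_space scale"
  shows "gsc_ideal scale (ES scale)" "range (\<lambda>v. upper_tensor scale 4 [[v, v], [v]]) \<subseteq> ES scale 4"
proof -
  have T: "\<forall>l\<ge>1. ext_generators scale l \<subseteq> TS scale l"
    by (auto simp: ext_generators_def TS_def upper_tensor_def)
  have ESI: "z \<in> ES scale l" if "\<And>I. gsc_ideal scale I \<Longrightarrow> (\<forall>l\<ge>1. ext_generators scale l \<subseteq> I l) \<Longrightarrow> z \<in> I l"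
    for z l using that by (auto simp: ES_def gsc_ideal_generated_def)
  have ESD: "z \<in> I l" if "z \<in> ES scale l" "gsc_ideal scale I" "\<forall>l\<ge>1. ext_generators scale l \<subseteq> I l" for z l I
    using that by (auto simp: ES_def gsc_ideal_generated_def)
  show "range (\<lambda>v. upper_tensor scale 4 [[v, v], [v]]) \<subseteq> ES scale 4"
  proof (intro subsetI ESI)
    fix z I assume "z \<in> range (\<lambda>v. upper_tensor scale 4 [[v, v], [v]])"
      "\<forall>l\<ge>1. ext_generators scale l \<subseteq> I l"
    moreover from this(2) have "ext_generators scale 4 \<subseteq> I 4" by simp
    ultimately show "z \<in> I 4" unfolding ext_generators_def by (simp add: subset_iff)
  qed
  show "gsc_ideal scale (ES scale)"
    unfolding gsc_ideal_def
  proof (intro conjI allI impI ballI)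
    fix m :: nat assume m: "1 \<le> m"
    show "ES scale m \<subseteq> TS scale m" using ESD[OF _ gsc_ideal_TS[OF V] T] by blast
    have s: "fun_vs.subspace (I m)" if "gsc_ideal scale I" for I
      using that m by (simp add: gsc_ideal_def)
    show "fun_vs.subspace (ES scale m)"
      unfolding ES_def gsc_ideal_generated_def
      using s by (intro fun_vs.subspace_Inter) auto
  next
    fix m n i x y A
    assume *: "1 \<le> m" "1 \<le> n" "x \<in> ES scale m" "y \<in> TS scale n" "A \<in> BV scale m n"
    show "diamond scale m n i x A y \<in> ES scale (m + n - 1)" if "i \<in> {1..m}"
    proof (rule ESI)
      fix I assume I: "gsc_ideal scale I" "\<forall>l\<ge>1. ext_generators scale l \<subseteq> I l"
      show "diamond scale m n i x A y \<in> I (m + n - 1)"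
        using I(1) ESD[OF *(3) I] * that unfolding gsc_ideal_def by blast
    qed
    show "diamond scale n m i y (tensor_transpose scale m n A) x \<in> ES scale (m + n - 1)"
      if "i \<in> {1..n}"
    proof (rule ESI)
      fix I assume I: "gsc_ideal scale I" "\<forall>l\<ge>1. ext_generators scale l \<subseteq> I l"
      show "diamond scale n m i y (tensor_transpose scale m n A) x \<in> I (m + n - 1)"
        using I(1) ESD[OF *(3) I] * that unfolding gsc_ideal_def by blast
    qed
  qed
qed

lemma fcoset_eq_iff:
  assumes "fun_vs.subspace U"
  shows "fcoset U x = fcoset U y \<longleftrightarrow> x - y \<in> U"
proof
  assume "fcoset U x = fcoset U y"
  moreover have "x \<in> fcoset U x"
    using fun_vs.subspace_0[OF assms] unfolding fcoset_def by force
  ultimately show "x - y \<in> U" by (auto simp: fcoset_def)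
next
  assume xy: "x - y \<in> U"
  have "x + u = y + ((x - y) + u)" "y + u = x + (u - (x - y))" for u by auto
  then show "fcoset U x = fcoset U y"
    unfolding fcoset_def
    using fun_vs.subspace_add[OF assms xy] fun_vs.subspace_diff[OF assms _ xy] by blast
qed

lemma fcoset_add:
  assumes "fun_vs.subspace U"
  shows "{a + b | a b. a \<in> fcoset U x \<and> b \<in> fcoset U y} = fcoset U (x + y)"
proof (intro equalityI subsetI)
  fix z assume "z \<in> {a + b | a b. a \<in> fcoset U x \<and> b \<in> fcoset U y}"
  then obtain u v where "u \<in> U" "v \<in> U" "z = (x + u) + (y + v)" by (auto simp: fcoset_def)
  then show "z \<in> fcoset U (x + y)"
    using fun_vs.subspace_add[OF assms]
    by (auto simp: fcoset_def intro!: exI[of _ "u + v"])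
next
  fix z assume "z \<in> fcoset U (x + y)"
  then obtain u where u: "u \<in> U" "z = x + y + u" by (auto simp: fcoset_def)
  have "x = x + 0" "z = x + (y + u)" using u by (auto simp: add.assoc)
  then show "z \<in> {a + b | a b. a \<in> fcoset U x \<and> b \<in> fcoset U y}"
    using u fun_vs.subspace_0[OF assms] unfolding fcoset_def by blast
qed

lemma fcoset_scale:
  assumes "fun_vs.subspace U"
  shows "{fscale c a + u | a u. a \<in> fcoset U x \<and> u \<in> U} = fcoset U (fscale c x)"
proof (intro equalityI subsetI)
  fix z assume "z \<in> {fscale c a + u | a u. a \<in> fcoset U x \<and> u \<in> U}"
  then obtain u v where "u \<in> U" "v \<in> U" "z = fscale c (x + u) + v" by (auto simp: fcoset_def)
  then show "z \<in> fcoset U (fscale c x)"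
    using fun_vs.subspace_add[OF assms] fun_vs.subspace_scale[OF assms]
    by (auto simp: fcoset_def fun_vs.scale_right_distrib add.assoc
      intro!: exI[of _ "fscale c u + v"])
next
  fix z assume "z \<in> fcoset U (fscale c x)"
  then obtain u where u: "u \<in> U" "z = fscale c x + u" by (auto simp: fcoset_def)
  moreover have "x \<in> fcoset U x"
    using fun_vs.subspace_0[OF assms] unfolding fcoset_def by force
  ultimately show "z \<in> {fscale c a + u | a u. a \<in> fcoset U x \<and> u \<in> U}" by blast
qed

lemma vectorspace_quotient_space:
  fixes W U :: "('a \<Rightarrow> 'b::field) set"
  assumes W: "fun_vs.subspace W" and U: "fun_vs.subspace U"
  shows "vectorspace class_ring (quotient_space W U)"
proof -
  have U0: "U = fcoset U 0" by (auto simp: fcoset_def)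
  have add: "X \<oplus>\<^bsub>quotient_space W U\<^esub> Y = {x + y | x y. x \<in> X \<and> y \<in> Y}" for X Y
    by (simp add: quotient_space_def)
  have smult: "c \<odot>\<^bsub>quotient_space W U\<^esub> X = {fscale c x + u | x u. x \<in> X \<and> u \<in> U}" for c X
    by (simp add: quotient_space_def)
  have car: "carrier (quotient_space W U) = fcoset U ` W" and
    zero: "\<zero>\<^bsub>quotient_space W U\<^esub> = fcoset U 0"
    using U0 by (auto simp: quotient_space_def)
  note ops = add smult fcoset_add[OF U] fcoset_scale[OF U]
  let ?Q = "quotient_space W U"
  have mem: "fcoset U x \<in> carrier ?Q" if "x \<in> W" for x
    using that by (auto simp: car)
  have ag: "abelian_group ?Q"
  proof (rule abelian_groupI)
    fix X Y Z assume "X \<in> carrier ?Q" "Y \<in> carrier ?Q" "Z \<in> carrier ?Q"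
    then obtain x y z where x: "x \<in> W" "X = fcoset U x" and y: "y \<in> W" "Y = fcoset U y"
      and z: "z \<in> W" "Z = fcoset U z" by (auto simp: car)
    show "X \<oplus>\<^bsub>?Q\<^esub> Y \<oplus>\<^bsub>?Q\<^esub> Z = X \<oplus>\<^bsub>?Q\<^esub> (Y \<oplus>\<^bsub>?Q\<^esub> Z)"
      unfolding x y z ops by (simp add: add.assoc)
  next
    fix X Y assume "X \<in> carrier ?Q" "Y \<in> carrier ?Q"
    then obtain x y where x: "x \<in> W" "X = fcoset U x" and y: "y \<in> W" "Y = fcoset U y"
      by (auto simp: car)
    show "X \<oplus>\<^bsub>?Q\<^esub> Y = Y \<oplus>\<^bsub>?Q\<^esub> X" unfolding x y ops by (simp add: add.commute)
    show "X \<oplus>\<^bsub>?Q\<^esub> Y \<in> carrier ?Q"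
      unfolding x y ops by (intro mem fun_vs.subspace_add[OF W] x(1) y(1))
  next
    show "\<zero>\<^bsub>?Q\<^esub> \<in> carrier ?Q" unfolding zero by (intro mem fun_vs.subspace_0[OF W])
  next
    fix X assume "X \<in> carrier ?Q"
    then obtain x where x: "x \<in> W" "X = fcoset U x" by (auto simp: car)
    show "\<zero>\<^bsub>?Q\<^esub> \<oplus>\<^bsub>?Q\<^esub> X = X" unfolding x zero ops by simp
    have "fcoset U (- x) \<oplus>\<^bsub>?Q\<^esub> X = \<zero>\<^bsub>?Q\<^esub>" unfolding x zero ops by simp
    then show "\<exists>Y\<in>carrier ?Q. Y \<oplus>\<^bsub>?Q\<^esub> X = \<zero>\<^bsub>?Q\<^esub>"
      using mem[OF fun_vs.subspace_neg[OF W x(1)]] by blast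
  qed
  have "Module.module class_ring ?Q"
  proof (rule moduleI)
    show "cring (class_ring :: 'b ring)" by (rule class_cring.cring_axioms)
    show "abelian_group ?Q" by (rule ag)
  next
    fix a :: 'b and X assume "X \<in> carrier ?Q"
    then obtain x where x: "x \<in> W" "X = fcoset U x" by (auto simp: car)
    show "a \<odot>\<^bsub>?Q\<^esub> X \<in> carrier ?Q" unfolding x ops by (intro mem fun_vs.subspace_scale[OF W] x(1))
    show "\<one>\<^bsub>class_ring\<^esub> \<odot>\<^bsub>?Q\<^esub> X = X" unfolding x ops by simp
    fix b :: 'b
    show "(a \<oplus>\<^bsub>class_ring\<^esub> b) \<odot>\<^bsub>?Q\<^esub> X = a \<odot>\<^bsub>?Q\<^esub> X \<oplus>\<^bsub>?Q\<^esub> b \<odot>\<^bsub>?Q\<^esub> X"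
      unfolding x ops by (simp add: fun_vs.scale_left_distrib)
    show "a \<otimes>\<^bsub>class_ring\<^esub> b \<odot>\<^bsub>?Q\<^esub> X = a \<odot>\<^bsub>?Q\<^esub> (b \<odot>\<^bsub>?Q\<^esub> X)"
      unfolding x ops by simp
  next
    fix a :: 'b and X Y assume "X \<in> carrier ?Q" "Y \<in> carrier ?Q"
    then obtain x y where x: "x \<in> W" "X = fcoset U x" and y: "y \<in> W" "Y = fcoset U y"
      by (auto simp: car)
    show "a \<odot>\<^bsub>?Q\<^esub> (X \<oplus>\<^bsub>?Q\<^esub> Y) = a \<odot>\<^bsub>?Q\<^esub> X \<oplus>\<^bsub>?Q\<^esub> a \<odot>\<^bsub>?Q\<^esub> Y"
      unfolding x y ops by (simp add: fun_vs.scale_right_distrib)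
  qed
  then show ?thesis
    using class_field.field_axioms by (rule vectorspace.intro)
qed

lemma vectorspace_Lam:
  assumes "vector_space scale" "1 \<le> m"
  shows "vectorspace class_ring (Lam scale m)"
  unfolding Lam_def
  using assms gsc_ideal_ES(1)[OF assms(1)] gsc_ideal_TS[OF assms(1)]
  by (intro vectorspace_quotient_space) (auto simp: gsc_ideal_def)

text \<open>
  Over the field with two elements the four classes below do not span: the tensors
  \<open>v \<otimes> v \<otimes> v\<close> span a space of dimension three instead of four, so the quotient has dimension
  five. This is why the statement about \<open>m = 4\<close> (and that about \<open>m = 5\<close>, where the quotient has
  dimension six) requires a field with a third element.
\<close>

lemma glue_1: "glue 1 i u w v = u"
  by (auto simp: glue_def new_index_def old_pos_def fun_eq_iff)

lemma tri_pos_4: "tri_pos 4 = {(1, 2), (1, 3), (2, 3)}"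
  by (auto simp: tri_pos_def)

lemma empty_pos: "tri_pos 1 = {}" "tri_pos 2 = {}" "rect_pos m 1 = {}" "rect_pos 1 m = {}"
  by (auto simp: tri_pos_def rect_pos_def)

lemma not_Lam_basis_4_two_elements:
  fixes scale :: "'k::field \<Rightarrow> 'v::ab_group_add \<Rightarrow> 'v" and a b :: 'v
  assumes V: "vector_space scale" and ab: "a \<noteq> b" "\<not> Modules.module.dependent scale {a, b}"
    and two: "\<And>c::'k. c = 0 \<or> c = 1"
  shows "\<not> Lam_basis scale 4
    [wedge scale 4 [[a, a], [b]], wedge scale 4 [[a, b], [a]],
     wedge scale 4 [[b, b], [a]], wedge scale 4 [[a, b], [b]]]"
proof
  assume basis: "Lam_basis scale 4
    [wedge scale 4 [[a, a], [b]], wedge scale 4 [[a, b], [a]],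
     wedge scale 4 [[b, b], [a]], wedge scale 4 [[a, b], [b]]]"
  interpret V: vector_space scale by fact
  interpret k: vector_space "(*) :: 'k \<Rightarrow> 'k \<Rightarrow> 'k" by (rule vector_space_mult)
  interpret P: vector_space_pair scale "(*) :: 'k \<Rightarrow> 'k \<Rightarrow> 'k" ..
  have "(1::'k) + 1 \<noteq> 1 + 0" unfolding add_left_cancel by simp
  then have char2: "1 + 1 = (0 :: 'k)" using two[of "1 + 1"] by simp
  obtain \<alpha> where \<alpha>: "Vector_Spaces.linear scale (*) \<alpha>" "\<alpha> a = 1" "\<alpha> b = (0::'k)"
    using P.linear_independent_extend[OF ab(2), of "\<lambda>x. if x = a then 1 else 0"] ab(1) by auto
  obtain \<beta> where \<beta>: "Vector_Spaces.linear scale (*) \<beta>" "\<beta> a = (0::'k)" "\<beta> b = 1"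
    using P.linear_independent_extend[OF ab(2), of "\<lambda>x. if x = b then 1 else 0"] ab(1) by auto
  define \<phi> where "\<phi> f = \<beta> (f (1, 2)) * \<alpha> (f (1, 3)) * (\<alpha> (f (2, 3)) + \<beta> (f (2, 3)))"
    for f :: "nat \<times> nat \<Rightarrow> 'v"
  have lin: "\<alpha> (x + y) = \<alpha> x + \<alpha> y" "\<alpha> (scale c x) = c * \<alpha> x"
    "\<beta> (x + y) = \<beta> x + \<beta> y" "\<beta> (scale c x) = c * \<beta> x" for x y c
    using \<alpha>(1) \<beta>(1) by (simp_all add: Vector_Spaces.linear_iff)
  have ml: "multilinear_on scale (tri_pos 4) \<phi>"
  proof (rule multilinear_onI[OF V])
    fix f :: "nat \<times> nat \<Rightarrow> 'v" and s x y c assume "s \<in> tri_pos 4"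
    then consider "s = (1, 2)" | "s = (1, 3)" | "s = (2, 3)" by (auto simp: tri_pos_4)
    note s = this
    show "\<phi> (f(s := x + y)) = \<phi> (f(s := x)) + \<phi> (f(s := y))"
      using s by cases (simp_all add: \<phi>_def lin distrib_left distrib_right)
    show "\<phi> (f(s := scale c x)) = c * \<phi> (f(s := x))"
      using s by cases (simp_all add: \<phi>_def lin distrib_left)
  qed (simp add: \<phi>_def tri_pos_4)
  have on_upper: "upper_tensor scale 4 [[u, v], [w]] \<phi> = \<beta> u * \<alpha> v * (\<alpha> w + \<beta> w)" for u v w
    by (simp add: upper_tensor_def simple_tensor_def ml) (simp add: \<phi>_def upper_matrix_def)
  have cube: "\<beta> v * \<alpha> v * (\<alpha> v + \<beta> v) = 0" for v
    using two[of "\<alpha> v"] two[of "\<beta> v"] char2 by auto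
  define N where "N = {x \<in> TS scale 4. x \<phi> = 0}"
  have N: "fun_vs.subspace N"
    unfolding N_def TS_def
    by (rule fun_vs.subspaceI) (auto simp: tensor_power_closed fscale_apply)
  define J where "J m = (if m < 4 then {0} else if m = 4 then N else TS scale m)" for m :: nat
  have J0: "0 \<in> J m" for m
    using fun_vs.subspace_0[OF N] by (simp add: J_def TS_def tensor_power_closed)
  have JT: "J m \<subseteq> TS scale m" for m
    by (auto simp: J_def N_def TS_def tensor_power_closed)
  have const: "multilinear_on scale {} (\<lambda>_ :: nat \<times> nat \<Rightarrow> 'v. c)" for c :: 'k
    by (rule multilinear_onI[OF V]) auto
  have "gsc_ideal scale J"
    unfolding gsc_ideal_def
  proof (intro conjI allI impI ballI)
    fix m :: nat
    show "fun_vs.subspace (J m)"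
      using N by (auto simp: J_def TS_def tensor_power_def)
    show "J m \<subseteq> TS scale m" by (rule JT)
  next
    fix m n :: nat and i x y A
    assume m: "1 \<le> m" and n: "1 \<le> n" and x: "x \<in> J m" and y: "y \<in> TS scale n" and A: "A \<in> BV scale m n"
    note xT = subsetD[OF JT x]
    note A' = tensor_transpose_in_BV[OF V A]
    consider "m < 4" | "m = 4" "n = 1" | "m + n - 1 > 4" using m n by linarith
    note cases = this
    show "diamond scale m n i x A y \<in> J (m + n - 1)" if i: "i \<in> {1..m}"
      using cases
    proof cases
      case 1
      then have "x = 0" using x by (simp add: J_def)
      then have "diamond scale m n i x A y = 0" by (auto simp: diamond_def fun_eq_iff)
      then show ?thesis using J0 by simp
    next
      case 2
      have xN: "x \<in> TS scale 4" "x \<phi> = 0" using x 2 by (simp_all add: J_def N_def)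
      have T: "diamond scale m n i x A y \<in> TS scale (m + n - 1)"
        using diamond_in_TS[OF m n _ _ V xT A y] i by simp
      have yc: "y (\<lambda>v. c) = c * y (\<lambda>v. 1)" for c
        using tensor_power_homogeneous[OF y[unfolded TS_def], of "\<lambda>_. 1" c] const 2
        by (simp del: One_nat_def add: empty_pos)
      have Ac: "A (\<lambda>w. c) = c * A (\<lambda>w. 1)" for c
        using tensor_power_homogeneous[OF A[unfolded BV_def], of "\<lambda>_. 1" c] const 2
        by (simp del: One_nat_def add: empty_pos)
      have "x (\<lambda>u. A (\<lambda>w. y (\<lambda>v. \<phi> u))) = x (\<lambda>u. (y (\<lambda>v. 1) * A (\<lambda>w. 1)) * \<phi> u)"
      proof (rule arg_cong[of _ _ x], rule ext)
        fix u
        have "A (\<lambda>w. y (\<lambda>v. \<phi> u)) = A (\<lambda>w. \<phi> u * y (\<lambda>v. 1))"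
          by (rule arg_cong[of _ _ A], rule ext, rule yc)
        also have "\<dots> = (\<phi> u * y (\<lambda>v. 1)) * A (\<lambda>w. 1)" by (rule Ac)
        finally show "A (\<lambda>w. y (\<lambda>v. \<phi> u)) = (y (\<lambda>v. 1) * A (\<lambda>w. 1)) * \<phi> u"
          by (simp only: mult_ac)
      qed
      also have "\<dots> = 0"
        using tensor_power_homogeneous[OF xN(1)[unfolded TS_def] ml] xN(2) by simp
      finally have "diamond scale m n i x A y \<phi> = 0"
        using 2 ml by (simp add: diamond_def glue_1 del: One_nat_def)
      then show ?thesis using T 2 by (simp add: J_def N_def)
    next
      case 3
      then show ?thesis
        using diamond_in_TS[OF m n _ _ V xT A y] i by (simp add: J_def)
    qed
    show "diamond scale n m i y (tensor_transpose scale m n A) x \<in> J (m + n - 1)" if i: "i \<in> {1..n}"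
      using cases
    proof cases
      case 1
      then have "x = 0" using x by (simp add: J_def)
      then have "diamond scale n m i y (tensor_transpose scale m n A) x = 0"
        using diamond_scale(3)[OF n m _ _ V y A' xT, of i 0] i by simp
      then show ?thesis using J0 by simp
    next
      case 2
      have xN: "x \<in> TS scale 4" "x \<phi> = 0" using x 2 by (simp_all add: J_def N_def)
      have "\<phi> (glue 4 1 u w v) = \<phi> v" for u w v
        by (rule multilinear_on_cong[OF ml]) (auto simp: tri_pos_4 glue_def new_index_def numeral_2_eq_2 numeral_3_eq_3)
      moreover have "y (\<lambda>u. 0) = 0"
        using tensor_power_homogeneous[OF y[unfolded TS_def], of "\<lambda>_. 1" 0] const 2
        by (simp del: One_nat_def add: empty_pos)
      moreover have "tensor_transpose scale m n A (\<lambda>u. 0) = 0"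
        using tensor_power_homogeneous[OF A'[unfolded BV_def], of "\<lambda>_. 1" 0] const 2
        by (simp del: One_nat_def add: empty_pos)
      ultimately have "diamond scale n m 1 y (tensor_transpose scale m n A) x \<phi> = 0"
        using 2 xN(2) by (simp add: diamond_def del: One_nat_def)
      moreover have "diamond scale n m i y (tensor_transpose scale m n A) x \<in> TS scale (m + n - 1)"
        using diamond_in_TS[OF n m _ _ V y A' xT] i by (simp add: add.commute)
      ultimately show ?thesis
        using 2 i by (simp add: J_def N_def)
    next
      case 3
      then show ?thesis
        using diamond_in_TS[OF n m _ _ V y A' xT] i by (simp add: J_def add.commute)
    qed
  qed
  moreover have "\<forall>l\<ge>1. ext_generators scale l \<subseteq> J l"
    by (auto simp: ext_generators_def J_def N_def on_upper cube)
      (simp add: upper_tensor_def TS_def)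
  ultimately have "ES scale 4 \<subseteq> J 4"
    unfolding ES_def gsc_ideal_generated_def by (intro Inter_lower) blast
  then have EN: "ES scale 4 \<subseteq> N" by (simp add: J_def)
  have E: "fun_vs.subspace (ES scale 4)"
    using gsc_ideal_ES(1)[OF V] by (simp add: gsc_ideal_def)
  interpret L: vectorspace class_ring "Lam scale 4"
    using vectorspace_Lam[OF V] by simp
  let ?N = "fcoset (ES scale 4) ` N"
  have "submodule class_ring ?N (Lam scale 4)"
  proof
    show "?N \<subseteq> carrier (Lam scale 4)" by (auto simp: Lam_def quotient_space_def N_def)
    show "\<zero>\<^bsub>Lam scale 4\<^esub> \<in> ?N"
      using fun_vs.subspace_0[OF N]
      by (auto simp: Lam_def quotient_space_def fcoset_def intro!: image_eqI[of _ _ 0])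
  next
    fix v w assume "v \<in> ?N" "w \<in> ?N"
    then show "v \<oplus>\<^bsub>Lam scale 4\<^esub> w \<in> ?N"
      using fcoset_add[OF E] fun_vs.subspace_add[OF N] by (auto simp: Lam_def quotient_space_def)
  next
    fix c :: 'k and v assume "v \<in> ?N"
    then show "c \<odot>\<^bsub>Lam scale 4\<^esub> v \<in> ?N"
      using fcoset_scale[OF E] fun_vs.subspace_scale[OF N] by (auto simp: Lam_def quotient_space_def)
  qed
  moreover have wN: "wedge scale 4 [[u, v], [w]] \<in> ?N" if "\<beta> u * \<alpha> v * (\<alpha> w + \<beta> w) = 0" for u v w
    using that on_upper[of u v w] by (auto simp: wedge_def N_def upper_tensor_def TS_def)
  ultimately have "L.span (set [wedge scale 4 [[a, a], [b]], wedge scale 4 [[a, b], [a]],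
     wedge scale 4 [[b, b], [a]], wedge scale 4 [[a, b], [b]]]) \<subseteq> ?N"
    by (intro L.span_is_subset) (auto simp: \<alpha> \<beta>)
  moreover have "wedge scale 4 [[b, a], [a]] \<in> carrier (Lam scale 4)"
    by (simp add: wedge_def Lam_def quotient_space_def upper_tensor_def TS_def)
  ultimately have "wedge scale 4 [[b, a], [a]] \<in> ?N"
    using basis unfolding Lam_basis_def L.basis_def by blast
  then obtain z where z: "z \<in> N" "upper_tensor scale 4 [[b, a], [a]] - z \<in> ES scale 4"
    unfolding wedge_def using fcoset_eq_iff[OF E] by auto
  then have "(upper_tensor scale 4 [[b, a], [a]] - z) + z \<in> N"
    using EN fun_vs.subspace_add[OF N] by blast
  then have "upper_tensor scale 4 [[b, a], [a]] \<phi> = 0" by (simp add: N_def)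
  then show False by (simp add: on_upper \<alpha> \<beta>)
qed

end

(* The ideal is spanned by the simple tensors having a monochromatic triangle, i.e. indices x < y < z
   whose three entries at (x, y), (x, z), (y, z) coincide: compositions preserve such triangles, and any of
   them arises from a generator by inserting one index after the other. By multilinearity the quotient is
   then spanned by the edge colourings, with colours a and b, of the complete graph on m - 1 vertices.

   A colouring of K_5 without monochromatic triangle is a pentagon and its complement. Recolouring one
   of its triangles non-trivially changes some vertex degree, hence creates a monochromatic triangle. So the
   relation for v = a + b at that triangle expresses the colouring through elements of the ideal, over every
   field, and all quotients with m > 5 vanish. For m = 4, 5, with a third element in the field, the relations
   aab + aba + baa and abb + bab + bba at each triangle reduce every colouring to the listed ones;
   for m = 5 they identify, up to sign, the twelve Hamiltonian paths of K_4 and kill the rest.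
   Independence is detected by multilinear forms vanishing on monochromatic triangles. *)
theory Submission imports Defs
begin

section \<open>Monochromatic triangles under composition\<close>

text \<open>The colours are of arbitrary type: the predicate serves for matrices over the vector
  space and for the Boolean colourings of K_5 below.\<close>

definition mono_triangle :: "nat \<Rightarrow> (nat \<times> nat \<Rightarrow> 'v) \<Rightarrow> bool" where
  "mono_triangle m f \<longleftrightarrow>
     (\<exists>x y z. 1 \<le> x \<and> x < y \<and> y < z \<and> z < m \<and> f (x, y) = f (x, z) \<and> f (x, z) = f (y, z))"

lemma mono_triangleI:
  "1 \<le> x \<Longrightarrow> x < y \<Longrightarrow> y < z \<Longrightarrow> z < m \<Longrightarrow> f (x, y) = f (x, z) \<Longrightarrow> f (x, z) = f (y, z) \<Longrightarrow>
    mono_triangle m f"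
  unfolding mono_triangle_def by blast

lemma simple_tensor_in_TS [simp]: "simple_tensor scale (tri_pos m) f \<in> TS scale m"
  by (simp add: TS_def)

lemma simple_tensor_in_BV [simp]: "simple_tensor scale (rect_pos m n) f \<in> BV scale m n"
  by (simp add: BV_def)

lemma subspace_TS: "fun_vs.subspace (TS scale m)"
  by (simp add: TS_def tensor_power_def)

lemma span_simple_tensors_subset_TS:
  "fun_vs.span (simple_tensor scale (tri_pos m) ` F) \<subseteq> TS scale m"
  by (rule fun_vs.span_minimal) (auto simp: subspace_TS)

text \<open>Trilinearity reduces membership to the glued matrices. The sets \<open>F\<close> and
  \<open>G\<close> limit which matrices occur in the two outer slots; for ideals one of them is the
  set of matrices with a monochromatic triangle and the other is \<open>UNIV\<close>.\<close>

lemma diamond_in_subspace: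
  fixes scale :: "'k::field \<Rightarrow> 'v::ab_group_add \<Rightarrow> 'v"
  assumes V: "vector_space scale" and mn: "1 \<le> m" "1 \<le> n" "1 \<le> i" "i \<le> m"
    and W: "fun_vs.subspace W"
    and glue: "\<And>u w v. u \<in> F \<Longrightarrow> v \<in> G \<Longrightarrow>
      simple_tensor scale (tri_pos (m + n - 1)) (glue n i u w v) \<in> W"
    and x: "x \<in> fun_vs.span (simple_tensor scale (tri_pos m) ` F)"
    and A: "A \<in> BV scale m n"
    and y: "y \<in> fun_vs.span (simple_tensor scale (tri_pos n) ` G)"
  shows "diamond scale m n i x A y \<in> W"
proof -
  let ?D = "diamond scale m n i"
  let ?u = "simple_tensor scale (tri_pos m)"
  let ?w = "simple_tensor scale (rect_pos m n)"
  let ?v = "simple_tensor scale (tri_pos n)"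
  note D_add = diamond_add[OF mn V] and D_scale = diamond_scale[OF mn V]
  have D0: "?D x 0 y = 0" "?D x A 0 = 0" "?D 0 A y = 0"
    if "x \<in> TS scale m" "A \<in> BV scale m n" "y \<in> TS scale n" for x y A
    using D_scale(1)[of 0 x A y] D_scale(2,3)[OF that, of 0] by simp_all
  \<comment> \<open>The slots are released one at a time: first \<open>y\<close>, then
    \<open>A\<close>, then \<open>x\<close>.\<close>
  have 1: "?D (?u f) (?w g) y \<in> W" if f: "f \<in> F" for f g
  proof -
    have "fun_vs.subspace {y \<in> TS scale n. ?D (?u f) (?w g) y \<in> W}"
      by (rule fun_vs.subspaceI)
        (auto simp: D_add(3) D_scale(3) D0[of _ "?w g" "?v undefined"] fun_vs.subspace_0[OF W] fun_vs.subspace_add[OF W]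
          fun_vs.subspace_scale[OF W] fun_vs.subspace_0[OF subspace_TS]
          fun_vs.subspace_add[OF subspace_TS] fun_vs.subspace_scale[OF subspace_TS])
    moreover have "?v ` G \<subseteq> {y \<in> TS scale n. ?D (?u f) (?w g) y \<in> W}"
      using glue[OF f] by (auto simp: diamond_simple_tensor[OF mn V])
    ultimately show ?thesis
      using y fun_vs.span_minimal by blast
  qed
  have yT: "y \<in> TS scale n"
    using y span_simple_tensors_subset_TS by blast
  have 2: "?D (?u f) A y \<in> W" if f: "f \<in> F" for f
    using A unfolding BV_def
  proof (induction A rule: tensor_power_induct)
    case zero
    have "?D (?u f) 0 y = 0" using D0[of "?u f" "?w undefined" y] yT by simp
    then show ?case using fun_vs.subspace_0[OF W] by (simp del: zero_fun_apply)
  next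
    case (step c g z)
    have z: "z \<in> BV scale m n" and g: "fscale c (?w g) \<in> BV scale m n"
      using step(1) by (simp_all add: BV_def tensor_power_closed)
    show ?case
      unfolding D_add(2)[OF simple_tensor_in_TS g z yT]
        D_scale(2)[OF simple_tensor_in_TS simple_tensor_in_BV yT]
      by (intro fun_vs.subspace_add[OF W] fun_vs.subspace_scale[OF W] 1 f step(2))
  qed
  have "fun_vs.subspace {x \<in> TS scale m. ?D x A y \<in> W}"
    by (rule fun_vs.subspaceI)
      (auto simp: D_add(1) D_scale(1) D0[OF _ A yT, of "?u undefined"] fun_vs.subspace_0[OF W] fun_vs.subspace_add[OF W]
        fun_vs.subspace_scale[OF W] fun_vs.subspace_0[OF subspace_TS]
        fun_vs.subspace_add[OF subspace_TS] fun_vs.subspace_scale[OF subspace_TS])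
  moreover have "?u ` F \<subseteq> {x \<in> TS scale m. ?D x A y \<in> W}"
    using 2 by auto
  ultimately show ?thesis
    using x fun_vs.span_minimal by blast
qed

lemma mono_triangle_glue_old:
  assumes "1 \<le> n" "1 \<le> i" "mono_triangle m u"
  shows "mono_triangle (m + n - 1) (glue n i u w v)"
proof -
  from assms(3) obtain x y z where t: "1 \<le> x" "x < y" "y < z" "z < m"
    "u (x, y) = u (x, z)" "u (x, z) = u (y, z)" unfolding mono_triangle_def by blast
  \<comment> \<open>\<open>g\<close> inverts \<open>old_pos\<close> on the old indices: it jumps
    over the block of \<open>n - 1\<close> new ones and preserves the order.\<close>
  define g where "g t = (if t < i then t else t + n - 1)" for t
  have g: "\<not> new_index n i (g t)" "old_pos n i (g t) = t" if "1 \<le> t" for t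
    using that assms by (auto simp: g_def new_index_def old_pos_def)
  have less: "g s < g t" if "s < t" for s t
    using that assms by (auto simp: g_def)
  show ?thesis
  proof (rule mono_triangleI[of "g x" "g y" "g z"])
    show "1 \<le> g x" "g z < m + n - 1" using t assms by (auto simp: g_def)
  qed (use t less g in \<open>auto simp: glue_def\<close>)
qed

lemma mono_triangle_glue_new:
  assumes "1 \<le> m" "1 \<le> i" "i \<le> m" "mono_triangle n v"
  shows "mono_triangle (m + n - 1) (glue n i u w v)"
proof -
  from assms(4) obtain x y z where t: "1 \<le> x" "x < y" "y < z" "z < n"
    "v (x, y) = v (x, z)" "v (x, z) = v (y, z)" unfolding mono_triangle_def by blast
  show ?thesis
    by (rule mono_triangleI[of "x + i - 1" "y + i - 1" "z + i - 1"])
      (use t assms in \<open>auto simp: glue_def new_index_def\<close>)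
qed

section \<open>The ideal as the span of matrices with a monochromatic triangle\<close>

text \<open>The increasing map whose image omits exactly \<open>i\<close>; composing a matrix with
  it deletes the index \<open>i\<close>.\<close>

definition skip :: "nat \<Rightarrow> nat \<Rightarrow> nat" where
  "skip i p = (if p < i then p else Suc p)"

lemma ES_diamond:
  assumes "vector_space scale" "1 \<le> m" "1 \<le> n" "1 \<le> i" "i \<le> m"
    and "x \<in> ES scale m" "A \<in> BV scale m n" "y \<in> TS scale n"
  shows "diamond scale m n i x A y \<in> ES scale (m + n - 1)"
proof -
  have "\<forall>i\<in>{1..m}. diamond scale m n i x A y \<in> ES scale (m + n - 1)"
    using gsc_ideal_ES(1)[OF assms(1)] assms(2,3,6-8) unfolding gsc_ideal_def by blast
  then show ?thesis using assms(4,5) by simp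
qed

text \<open>Composition with the one-dimensional space for \<open>n = 2\<close> creates a single new
  index \<open>i\<close>. The middle factor supplies the entries in its row and column, so these can
  be chosen freely.\<close>

lemma ES_insert_index:
  assumes V: "vector_space scale" and i: "1 \<le> i" "i \<le> m"
    and f: "simple_tensor scale (tri_pos m) (\<lambda>(p, q). f (skip i p, skip i q)) \<in> ES scale m"
  shows "simple_tensor scale (tri_pos (Suc m)) f \<in> ES scale (Suc m)"
proof -
  let ?u = "\<lambda>(p, q). f (skip i p, skip i q)"
  \<comment> \<open>Entry \<open>(r, 1)\<close> joins the new index to the old index
    \<open>r\<close>, which is called \<open>Suc r\<close> after the insertion if it is at least
    \<open>i\<close>. The new index is the larger one only for \<open>r < i\<close>.\<close>
  define w where "w = (\<lambda>(r, s :: nat). if r < i then f (r, i) else f (i, Suc r))"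
  have "diamond scale m 2 i (simple_tensor scale (tri_pos m) ?u) (simple_tensor scale (rect_pos m 2) w)
    (simple_tensor scale (tri_pos 2) f) \<in> ES scale (m + 2 - 1)"
    using i f by (intro ES_diamond[OF V]) auto
  then have "simple_tensor scale (tri_pos (Suc m)) (glue 2 i ?u w f) \<in> ES scale (Suc m)"
    using i by (subst (asm) diamond_simple_tensor[OF _ _ _ _ V]) auto
  also have "simple_tensor scale (tri_pos (Suc m)) (glue 2 i ?u w f) =
      simple_tensor scale (tri_pos (Suc m)) f"
  proof (rule simple_tensor_cong)
    fix s assume "s \<in> tri_pos (Suc m)"
    moreover obtain p q where "s = (p, q)" by (cases s)
    ultimately have s: "s = (p, q)" "1 \<le> p" "p < q" "q < Suc m" by (auto simp: tri_pos_def)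
    have new: "new_index 2 i t \<longleftrightarrow> t = i" for t by (auto simp: new_index_def)
    have old: "skip i (old_pos 2 i t) = t" if "t \<noteq> i" for t
      using that i by (auto simp: skip_def old_pos_def)
    have lt: "old_pos 2 i t < i \<longleftrightarrow> t < i" "\<not> t < i \<Longrightarrow> Suc (old_pos 2 i t) = t" if "t \<noteq> i" for t
      using that by (auto simp: old_pos_def)
    have lt': "old_pos 2 i t = t" if "t < i" for t
      using that by (auto simp: old_pos_def)
    show "glue 2 i ?u w f s = f s"
      using s(3) by (auto simp: s(1) glue_def new old w_def lt lt')
  qed
  finally show ?thesis .
qed

text \<open>Induction on the size: as long as some index lies off the triangle it can be deleted,
  and re-inserting it stays in the ideal. When only the triangle is left, the tensor is a
  generator.\<close>

lemma mono_triangle_in_ES: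
  assumes V: "vector_space scale" and "mono_triangle m f"
  shows "simple_tensor scale (tri_pos m) f \<in> ES scale m"
  using assms(2)
proof (induction m arbitrary: f)
  case 0
  then show ?case by (simp add: mono_triangle_def)
next
  case (Suc m)
  then obtain x y z where t: "1 \<le> x" "x < y" "y < z" "z < Suc m"
    "f (x, y) = f (x, z)" "f (x, z) = f (y, z)" unfolding mono_triangle_def by blast
  show ?case
  proof (cases "m = 3")
    case True
    then have xyz: "x = 1" "y = 2" "z = 3" using t by auto
    have "simple_tensor scale (tri_pos 4) f = upper_tensor scale 4 [[f (1, 2), f (1, 2)], [f (1, 2)]]"
      unfolding upper_tensor_def
      by (rule simple_tensor_cong) (use t in \<open>auto simp: xyz tri_pos_4 upper_matrix_def\<close>)
    then show ?thesis
      using gsc_ideal_ES(2)[OF V] True by (auto simp: numeral_eq_Suc)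
  next
    case False
    then have m: "4 \<le> m" using t by auto
    \<comment> \<open>The least index that is not a corner of the triangle; it is at most 4, hence
      at most \<open>m\<close>.\<close>
    define i where "i = (if x \<noteq> 1 then 1 else if y \<noteq> 2 then 2 else if z \<noteq> 3 then 3 else 4 :: nat)"
    have i: "1 \<le> i" "i \<le> m" "i \<noteq> x" "i \<noteq> y" "i \<noteq> z"
      using m t by (auto simp: i_def)
    define g where "g t = (if t < i then t else t - 1)" for t
    have g: "skip i (g t) = t" if "t \<noteq> i" for t
      using that i by (auto simp: g_def skip_def)
    have less: "g s < g t" if "s < t" "t \<noteq> i" for s t
      using that i by (auto simp: g_def)
    have "1 \<le> g x" "g z < m" using t i by (auto simp: g_def)
    then have "mono_triangle m (\<lambda>(p, q). f (skip i p, skip i q))"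
      using t i by (intro mono_triangleI[of "g x" "g y" "g z"]) (simp_all add: g less)
    then show ?thesis
      by (intro ES_insert_index[OF V i(1,2)] Suc.IH)
  qed
qed

text \<open>The span is an ideal because a triangle in either outer factor survives gluing, and it
  contains the generators; minimality gives one inclusion, \<open>mono_triangle_in_ES\<close> the
  other.\<close>

lemma ES_eq_span_mono_triangle:
  assumes V: "vector_space scale" and m: "1 \<le> m"
  shows "ES scale m = fun_vs.span (simple_tensor scale (tri_pos m) ` {f. mono_triangle m f})"
proof
  define J where "J m = fun_vs.span (simple_tensor scale (tri_pos m) ` {f. mono_triangle m f})" for m
  have TS: "TS scale m = fun_vs.span (simple_tensor scale (tri_pos m) ` UNIV)" for m
    by (simp add: TS_def tensor_power_def)
  have J: "simple_tensor scale (tri_pos m) f \<in> J m" if "mono_triangle m f" for m f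
    using that unfolding J_def by (intro fun_vs.span_base) auto
  have "gsc_ideal scale J"
    unfolding gsc_ideal_def
  proof (intro conjI allI impI ballI)
    fix m show "fun_vs.subspace (J m)" unfolding J_def by simp
    show "J m \<subseteq> TS scale m" unfolding J_def by (rule span_simple_tensors_subset_TS)
  next
    fix m n i x y A
    assume *: "1 \<le> m" "1 \<le> n" "x \<in> J m" "y \<in> TS scale n" "A \<in> BV scale m n"
    have W: "fun_vs.subspace (J l)" for l unfolding J_def by simp
    show "diamond scale m n i x A y \<in> J (m + n - 1)" if "i \<in> {1..m}"
      by (rule diamond_in_subspace[OF V _ _ _ _ W _ *(3)[unfolded J_def] *(5) *(4)[unfolded TS]])
        (use * that in \<open>auto intro!: J mono_triangle_glue_old[unfolded One_nat_def]\<close>)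
    show "diamond scale n m i y (tensor_transpose scale m n A) x \<in> J (m + n - 1)" if "i \<in> {1..n}"
      by (rule diamond_in_subspace[OF V _ _ _ _ W _ *(4)[unfolded TS] tensor_transpose_in_BV[OF V *(5)]
            *(3)[unfolded J_def]])
        (use * that mono_triangle_glue_new[of n i m] in \<open>auto intro!: J simp: add.commute[of n]\<close>)
  qed
  moreover have "ext_generators scale l \<subseteq> J l" for l
    by (auto simp: ext_generators_def upper_tensor_def upper_matrix_def
        intro!: J mono_triangleI[of 1 2 3])
  ultimately have "ES scale m \<subseteq> J m"
    unfolding ES_def gsc_ideal_generated_def by (intro Inter_lower) blast
  then show "ES scale m \<subseteq> fun_vs.span (simple_tensor scale (tri_pos m) ` {f. mono_triangle m f})"
    by (simp add: J_def)
  show "fun_vs.span (simple_tensor scale (tri_pos m) ` {f. mono_triangle m f}) \<subseteq> ES scale m"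
    using gsc_ideal_ES(1)[OF V] m mono_triangle_in_ES[OF V]
    by (intro fun_vs.span_minimal) (auto simp: gsc_ideal_def)
qed

section \<open>Bases of quotients from dual functionals\<close>

text \<open>Evaluation at a point of \<open>\<phi>s\<close> is a linear functional on the function
  space. Since it vanishes on \<open>U\<close> it descends to the quotient, and duality to
  \<open>ws\<close> gives independence.\<close>

lemma quotient_space_basisI:
  fixes W U :: "('x \<Rightarrow> 'k::field) set" and ws :: "('x \<Rightarrow> 'k) list" and \<phi>s :: "'x list"
  assumes W: "fun_vs.subspace W" and U: "fun_vs.subspace U"
    and UW: "U \<subseteq> W" and ws: "set ws \<subseteq> W"
    and span: "W \<subseteq> fun_vs.span (set ws \<union> U)"
    and len: "length \<phi>s = length ws"
    and dual: "\<And>i j. i < length ws \<Longrightarrow> j < length ws \<Longrightarrow> (ws ! i) (\<phi>s ! j) = (if i = j then 1 else 0)"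
    and vanish: "\<And>u \<phi>. u \<in> U \<Longrightarrow> \<phi> \<in> set \<phi>s \<Longrightarrow> u \<phi> = 0"
  shows "distinct (map (fcoset U) ws)"
    and "vectorspace.basis class_ring (quotient_space W U) (set (map (fcoset U) ws))"
proof -
  let ?Q = "quotient_space W U" and ?B = "set (map (fcoset U) ws)"
  interpret Q: vectorspace class_ring ?Q by (rule vectorspace_quotient_space[OF W U])
  have submodule: "submodule class_ring (fcoset U ` N) ?Q" if N: "fun_vs.subspace N" "N \<subseteq> W" for N
  proof
    show "fcoset U ` N \<subseteq> carrier ?Q" using N by (auto simp: quotient_space_def)
    show "\<zero>\<^bsub>?Q\<^esub> \<in> fcoset U ` N"
      using fun_vs.subspace_0[OF N(1)]
      by (auto simp: quotient_space_def fcoset_def intro!: image_eqI[of _ _ 0])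
  next
    fix v w assume "v \<in> fcoset U ` N" "w \<in> fcoset U ` N"
    then show "v \<oplus>\<^bsub>?Q\<^esub> w \<in> fcoset U ` N"
      using fcoset_add[OF U] fun_vs.subspace_add[OF N(1)] by (auto simp: quotient_space_def)
  next
    fix c :: 'k and v assume "v \<in> fcoset U ` N"
    then show "c \<odot>\<^bsub>?Q\<^esub> v \<in> fcoset U ` N"
      using fcoset_scale[OF U] fun_vs.subspace_scale[OF N(1)] by (auto simp: quotient_space_def)
  qed
  have B: "?B \<subseteq> carrier ?Q" using ws by (auto simp: quotient_space_def)
  show "distinct (map (fcoset U) ws)"
    unfolding distinct_conv_nth
  proof (intro allI impI notI)
    fix i j assume ij: "i < length (map (fcoset U) ws)" "j < length (map (fcoset U) ws)" "i \<noteq> j"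
      and "map (fcoset U) ws ! i = map (fcoset U) ws ! j"
    then have "ws ! i - ws ! j \<in> U" using fcoset_eq_iff[OF U] by simp
    moreover have "\<phi>s ! i \<in> set \<phi>s" using ij(1) len by simp
    ultimately have "(ws ! i - ws ! j) (\<phi>s ! i) = 0" by (rule vanish)
    then show False using ij dual by simp
  qed
  have indpt: "Q.lin_indpt ?B"
  proof
    assume "Q.lin_dep ?B"
    then obtain X where X: "X \<in> ?B" "X \<in> Q.span (?B - {X})"
      using Q.lindep_span[OF B] by auto
    then obtain i where i: "i < length ws" "X = fcoset U (ws ! i)"
      by (auto simp: in_set_conv_nth)
    \<comment> \<open>The kernel of the i-th evaluation contains all the other
      \<open>ws ! j\<close>, so their span cannot reach the class of \<open>ws ! i\<close>.\<close>
    define N where "N = {w \<in> W. w (\<phi>s ! i) = 0}"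
    have N: "fun_vs.subspace N"
      unfolding N_def using W
      by (intro fun_vs.subspaceI)
        (auto simp: fscale_apply fun_vs.subspace_0 fun_vs.subspace_add fun_vs.subspace_scale)
    have "?B - {X} \<subseteq> fcoset U ` N"
    proof
      fix Y assume Y: "Y \<in> ?B - {X}"
      then have "Y \<in> ?B" by simp
      then obtain j where j: "j < length ws" "Y = fcoset U (ws ! j)"
        by (auto simp: in_set_conv_nth)
      with Y i(2) have "j \<noteq> i" by auto
      then have "ws ! j \<in> N" using ws i j(1) dual by (auto simp: N_def)
      then show "Y \<in> fcoset U ` N" using j by simp
    qed
    then have "Q.span (?B - {X}) \<subseteq> fcoset U ` N"
      by (rule Q.span_is_subset) (use submodule[OF N] in \<open>auto simp: N_def\<close>)
    then obtain w where w: "w \<in> N" "ws ! i - w \<in> U"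
      using X(2) fcoset_eq_iff[OF U] by (auto simp: i(2))
    moreover have "\<phi>s ! i \<in> set \<phi>s" using i len by simp
    ultimately have "(ws ! i - w) (\<phi>s ! i) = 0" using vanish by blast
    then show False using w(1) dual i by (simp add: N_def)
  qed
  have gen: "carrier ?Q \<subseteq> Q.span ?B"
  proof -
    have S: "submodule class_ring (Q.span ?B) ?Q" by (rule Q.span_is_submodule[OF B])
    \<comment> \<open>Pulling the span back to \<open>W\<close> gives a subspace containing
      \<open>ws\<close> and \<open>U\<close>, hence all of \<open>W\<close>.\<close>
    define W' where "W' = {w \<in> W. fcoset U w \<in> Q.span ?B}"
    have zero: "fcoset U u = \<zero>\<^bsub>?Q\<^esub>" if "u \<in> U" for u
    proof -
      have "fcoset U u = fcoset U 0" using that by (simp add: fcoset_eq_iff[OF U])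
      then show ?thesis by (simp add: quotient_space_def fcoset_def)
    qed
    have "fun_vs.subspace W'"
    proof (rule fun_vs.subspaceI)
      show "0 \<in> W'"
        using zero[OF fun_vs.subspace_0[OF U]] fun_vs.subspace_0[OF W] submodule.zero_closed[OF S]
        by (simp add: W'_def)
      show "x + y \<in> W'" if "x \<in> W'" "y \<in> W'" for x y
        using that submodule.m_closed[OF S, of "fcoset U x" "fcoset U y"] fun_vs.subspace_add[OF W]
        by (simp add: W'_def quotient_space_def fcoset_add[OF U])
      show "fscale c x \<in> W'" if "x \<in> W'" for c x
        using that submodule.smult_closed[OF S, of c "fcoset U x"] fun_vs.subspace_scale[OF W]
        by (simp add: W'_def quotient_space_def fcoset_scale[OF U])
    qed
    moreover have "set ws \<union> U \<subseteq> W'"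
      using ws UW Q.in_own_span[OF B] zero submodule.zero_closed[OF S] by (auto simp: W'_def)
    ultimately have "W \<subseteq> W'" using span fun_vs.span_minimal by blast
    then show ?thesis by (auto simp: W'_def quotient_space_def)
  qed
  show "Q.basis ?B" unfolding Q.basis_def using indpt gen B Q.span_closed[OF B] by blast
qed

lemma upper_tensor_in_TS: "upper_tensor scale m us \<in> TS scale m"
  by (simp add: upper_tensor_def)

text \<open>Tensors are functions on multilinear forms, so the forms themselves are the evaluation
  points. By \<open>ES_eq_span_mono_triangle\<close>, vanishing on the ideal only has to be tested
  on matrices with a monochromatic triangle.\<close>

lemma Lam_basisI:
  fixes scale :: "'k::field \<Rightarrow> 'v::ab_group_add \<Rightarrow> 'v"
    and \<phi>s :: "((nat \<times> nat \<Rightarrow> 'v) \<Rightarrow> 'k) list"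
  assumes V: "vector_space scale" and m: "1 \<le> m"
    and ml: "\<And>\<phi>. \<phi> \<in> set \<phi>s \<Longrightarrow> multilinear_on scale (tri_pos m) \<phi>"
    and vanish: "\<And>\<phi> f. \<phi> \<in> set \<phi>s \<Longrightarrow> mono_triangle m f \<Longrightarrow> \<phi> f = 0"
    and len: "length \<phi>s = length us"
    and dual: "\<And>i j. i < length us \<Longrightarrow> j < length us \<Longrightarrow>
      (\<phi>s ! j) (upper_matrix (us ! i)) = (if i = j then 1 else 0)"
    and span: "\<And>f. simple_tensor scale (tri_pos m) f \<in>
      fun_vs.span (set (map (upper_tensor scale m) us) \<union> ES scale m)"
  shows "Lam_basis scale m (map (wedge scale m) us)"
proof -
  have E: "fun_vs.subspace (ES scale m)" using gsc_ideal_ES(1)[OF V] m by (simp add: gsc_ideal_def)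
  have ET: "ES scale m \<subseteq> TS scale m" using gsc_ideal_ES(1)[OF V] m by (simp add: gsc_ideal_def)
  have "TS scale m \<subseteq> fun_vs.span (set (map (upper_tensor scale m) us) \<union> ES scale m)"
    unfolding TS_def tensor_power_def using span by (intro fun_vs.span_minimal) auto
  moreover have "u \<phi> = 0" if u: "u \<in> ES scale m" and \<phi>: "\<phi> \<in> set \<phi>s" for u \<phi>
  proof -
    have "fun_vs.subspace {u :: ('v, 'k) mtensor. u \<phi> = 0}"
      by (rule fun_vs.subspaceI) (auto simp: fscale_apply)
    then have "ES scale m \<subseteq> {u. u \<phi> = 0}"
      unfolding ES_eq_span_mono_triangle[OF V m]
      by (rule fun_vs.span_minimal[rotated]) (auto simp: simple_tensor_def vanish[OF \<phi>])
    with u show ?thesis by auto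
  qed
  ultimately have "distinct (map (fcoset (ES scale m)) (map (upper_tensor scale m) us)) \<and>
    vectorspace.basis class_ring (quotient_space (TS scale m) (ES scale m))
      (set (map (fcoset (ES scale m)) (map (upper_tensor scale m) us)))"
    using dual ml len
    by (intro conjI quotient_space_basisI[OF subspace_TS E ET, where \<phi>s = \<phi>s])
      (auto simp: upper_tensor_in_TS, simp_all add: upper_tensor_def simple_tensor_def)
  moreover have "map (fcoset (ES scale m)) (map (upper_tensor scale m) us) = map (wedge scale m) us"
    by (simp add: wedge_def)
  ultimately show ?thesis by (simp only: Lam_basis_def Lam_def)
qed

section \<open>Multilinear expansion and the relations at a triangle\<close>

lemma simple_tensor_upd_add:
  assumes "vector_space scale" "s \<in> S"
  shows "simple_tensor scale S (f(s := x + y)) =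
    simple_tensor scale S (f(s := x)) + simple_tensor scale S (f(s := y))"
  using multilinear_simple_tensor[OF assms] by (simp add: Vector_Spaces.linear_iff)

lemma simple_tensor_upd_scale:
  assumes "vector_space scale" "s \<in> S"
  shows "simple_tensor scale S (f(s := scale c x)) = fscale c (simple_tensor scale S (f(s := x)))"
  using multilinear_simple_tensor[OF assms] by (simp add: Vector_Spaces.linear_iff)

text \<open>Multilinearity lets the entries leave the spanning set \<open>B\<close> one position at
  a time.\<close>

lemma simple_tensor_in_subspaceI:
  fixes scale :: "'k::field \<Rightarrow> 'v::ab_group_add \<Rightarrow> 'v"
  assumes V: "vector_space scale" and S: "finite S"
    and B: "Modules.module.span scale B = UNIV" and M: "fun_vs.subspace M"
    and basis: "\<And>f. (\<And>s. s \<in> S \<Longrightarrow> f s \<in> B) \<Longrightarrow> simple_tensor scale S f \<in> M"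
  shows "simple_tensor scale S f \<in> M"
proof -
  interpret V: vector_space scale by fact
  \<comment> \<open>\<open>T\<close> is the set of positions whose entries are already
    arbitrary.\<close>
  have "\<forall>f. (\<forall>s\<in>S - T. f s \<in> B) \<longrightarrow> simple_tensor scale S f \<in> M" if "finite T" "T \<subseteq> S" for T
    using that
  proof (induction T rule: finite_induct)
    case empty
    then show ?case using basis by auto
  next
    case (insert t T)
    show ?case
    proof (intro allI impI)
      fix f assume f: "\<forall>s\<in>S - insert t T. f s \<in> B"
      have t: "t \<in> S" using insert.prems by simp
      \<comment> \<open>The zero entry is written as a multiple so that homogeneity shows the tensor
        to be zero.\<close>
      have "simple_tensor scale S (f(t := scale 0 0)) = 0"
        unfolding simple_tensor_upd_scale[OF V t] by simp
      then have "V.subspace {x. simple_tensor scale S (f(t := x)) \<in> M}"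
        by (intro V.subspaceI)
          (simp_all add: simple_tensor_upd_add[OF V t] simple_tensor_upd_scale[OF V t]
            fun_vs.subspace_0[OF M] fun_vs.subspace_add[OF M] fun_vs.subspace_scale[OF M])
      moreover have "B \<subseteq> {x. simple_tensor scale S (f(t := x)) \<in> M}"
        using insert.IH insert.prems f by auto
      ultimately have "f t \<in> {x. simple_tensor scale S (f(t := x)) \<in> M}"
        using V.span_minimal B by blast
      then show "simple_tensor scale S f \<in> M" by simp
    qed
  qed
  from this[OF S order_refl] show ?thesis by simp
qed

text \<open>\<open>T\<close> enters through an equation so that any notation for the tensor, such as
  \<open>upper_tensor\<close> with three variable entries, can be used directly.\<close>

lemma simple_tensor_trilinear:
  assumes V: "vector_space scale" and pqr: "p \<in> S" "q \<in> S" "r \<in> S" "distinct [p, q, r]"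
    and T: "\<And>u v w. T u v w = simple_tensor scale S (f(p := u, q := v, r := w))"
  shows "T (u + u') v w = T u v w + T u' v w" "T u (v + v') w = T u v w + T u v' w"
    "T u v (w + w') = T u v w + T u v w'"
    "T (scale c u) v w = fscale c (T u v w)" "T u (scale c v) w = fscale c (T u v w)"
    "T u v (scale c w) = fscale c (T u v w)"
proof -
  \<comment> \<open>The updates commute at distinct positions, so each of the three can be made the
    outermost one.\<close>
  have T': "T u v w = simple_tensor scale S (f(q := v, r := w, p := u))"
    "T u v w = simple_tensor scale S (f(p := u, r := w, q := v))" for u v w
    unfolding T using pqr(4) by (auto intro!: arg_cong[where f = "simple_tensor scale S"])
  note add = simple_tensor_upd_add[OF V] and scale = simple_tensor_upd_scale[OF V]
  show "T (u + u') v w = T u v w + T u' v w" "T (scale c u) v w = fscale c (T u v w)"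
    unfolding T'(1) by (rule add scale pqr)+
  show "T u (v + v') w = T u v w + T u v' w" "T u (scale c v) w = fscale c (T u v w)"
    unfolding T'(2) by (rule add scale pqr)+
  show "T u v (w + w') = T u v w + T u v w'" "T u v (scale c w) = fscale c (T u v w)"
    unfolding T by (rule add scale pqr)+
qed

lemma triangle_diagonal_in_ES:
  assumes V: "vector_space scale" and xyz: "1 \<le> x" "x < y" "y < z" "z < m"
    and T: "\<And>u v w. T u v w = simple_tensor scale (tri_pos m) (f((x, y) := u, (x, z) := v, (y, z) := w))"
  shows "T v v v \<in> ES scale m"
  unfolding T by (rule mono_triangle_in_ES[OF V], rule mono_triangleI[of x y z]) (use xyz in auto)

lemma subspace_ES:
  assumes "vector_space scale" "1 \<le> m"
  shows "fun_vs.subspace (ES scale m)"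
  using gsc_ideal_ES(1)[OF assms(1)] assms(2) by (simp add: gsc_ideal_def)

text \<open>The cubic polynomial \<open>T (a + c b) (a + c b) (a + c b)\<close> in \<open>c\<close> takes values in the ideal. Its
  linear and quadratic coefficients can be separated only with two distinct nonzero values of \<open>c\<close>.\<close>

lemma triangle_relations:
  fixes scale :: "'k::field \<Rightarrow> 'v::ab_group_add \<Rightarrow> 'v"
  assumes V: "vector_space scale" and xyz: "1 \<le> x" "x < y" "y < z" "z < m"
    and T: "\<And>u v w. T u v w = simple_tensor scale (tri_pos m) (f((x, y) := u, (x, z) := v, (y, z) := w))"
    and c: "c \<noteq> 0" "c \<noteq> (1 :: 'k)"
  shows "T a a b + T a b a + T b a a \<in> ES scale m" "T a b b + T b a b + T b b a \<in> ES scale m"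
proof -
  let ?L = "T a a b + T a b a + T b a a" and ?Q = "T a b b + T b a b + T b b a"
  have pos: "(x, y) \<in> tri_pos m" "(x, z) \<in> tri_pos m" "(y, z) \<in> tri_pos m"
    "distinct [(x, y), (x, z), (y, z)]"
    using xyz by (auto simp: tri_pos_def)
  note tri = simple_tensor_trilinear[OF V pos T]
  note diag = triangle_diagonal_in_ES[OF V xyz T]
  have E: "fun_vs.subspace (ES scale m)" using V xyz by (intro subspace_ES) auto
  \<comment> \<open>Expansion of the cube: the pure terms in \<open>a\<close> and in
    \<open>b\<close> are diagonal and lie in the ideal.\<close>
  have "fscale d ?L + fscale (d * d) ?Q =
      T (a + scale d b) (a + scale d b) (a + scale d b) - T a a a - fscale (d * d * d) (T b b b)" for d
    by (simp add: tri fun_vs.scale_right_distrib algebra_simps)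
  then have "fscale d ?L + fscale (d * d) ?Q \<in> ES scale m" for d
    by (simp only: diag fun_vs.subspace_diff[OF E] fun_vs.subspace_scale[OF E])
  note rel = this
  \<comment> \<open>Subtracting \<open>c\<close> times the relation at 1 from the relation at
    \<open>c\<close> cancels the linear part; the remaining factor \<open>c * (c - 1)\<close> is
    invertible.\<close>
  have "fscale (c * c - c) ?Q = (fscale c ?L + fscale (c * c) ?Q) - fscale c (fscale 1 ?L + fscale (1 * 1) ?Q)"
    by (simp add: fun_vs.scale_right_distrib fun_vs.scale_left_diff_distrib)
  also have "\<dots> \<in> ES scale m" by (intro fun_vs.subspace_diff[OF E] fun_vs.subspace_scale[OF E] rel)
  finally have "fscale (inverse (c * c - c)) (fscale (c * c - c) ?Q) \<in> ES scale m"
    by (rule fun_vs.subspace_scale[OF E])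
  moreover have "c * c - c \<noteq> 0" using c by simp
  ultimately show Q: "?Q \<in> ES scale m" by (simp add: fun_vs.scale_scale)
  have "?L = (fscale 1 ?L + fscale (1 * 1) ?Q) - ?Q" by simp
  also have "\<dots> \<in> ES scale m" by (intro fun_vs.subspace_diff[OF E] rel Q)
  finally show "?L \<in> ES scale m" .
qed

section \<open>Coordinate forms and small position sets\<close>

text \<open>If \<open>\<alpha>\<close> and \<open>\<beta>\<close> are dual to \<open>a\<close> and
  \<open>b\<close>, this is the coordinate function of the colouring with \<open>a\<close> on
  \<open>A\<close> and \<open>b\<close> on the rest of \<open>S\<close>.\<close>

definition coord_form ::
  "('v \<Rightarrow> 'k::field) \<Rightarrow> ('v \<Rightarrow> 'k) \<Rightarrow> 'i set \<Rightarrow> 'i set \<Rightarrow> ('i \<Rightarrow> 'v) \<Rightarrow> 'k" where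
  "coord_form \<alpha> \<beta> S A f = (\<Prod>s\<in>S. if s \<in> A then \<alpha> (f s) else \<beta> (f s))"

lemma multilinear_coord_form:
  fixes scale :: "'k::field \<Rightarrow> 'v::ab_group_add \<Rightarrow> 'v"
  assumes V: "vector_space scale" and S: "finite S"
    and lin: "Vector_Spaces.linear scale (*) \<alpha>" "Vector_Spaces.linear scale (*) \<beta>"
  shows "multilinear_on scale S (coord_form \<alpha> \<beta> S A)"
proof (rule multilinear_onI[OF V])
  \<comment> \<open>Isolates the only factor that depends on the entry at \<open>s\<close>.\<close>
  have upd: "coord_form \<alpha> \<beta> S A (f(s := x)) =
      (if s \<in> A then \<alpha> x else \<beta> x) * (\<Prod>t\<in>S - {s}. if t \<in> A then \<alpha> (f t) else \<beta> (f t))"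
    if "s \<in> S" for f s x
  proof -
    have "(\<Prod>t\<in>S - {s}. if t \<in> A then \<alpha> ((f(s := x)) t) else \<beta> ((f(s := x)) t)) =
        (\<Prod>t\<in>S - {s}. if t \<in> A then \<alpha> (f t) else \<beta> (f t))"
      by (rule prod.cong) auto
    then show ?thesis
      by (simp add: coord_form_def prod.remove[OF S that] fun_upd_same del: fun_upd_apply)
  qed
  show "coord_form \<alpha> \<beta> S A (f(s := x + y)) = coord_form \<alpha> \<beta> S A (f(s := x)) + coord_form \<alpha> \<beta> S A (f(s := y))"
    if "s \<in> S" for f s x y
    using lin by (simp add: upd[OF that] Vector_Spaces.linear_iff distrib_right)
  show "coord_form \<alpha> \<beta> S A (f(s := scale c x)) = c * coord_form \<alpha> \<beta> S A (f(s := x))"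
    if "s \<in> S" for f s c x
    using lin by (simp add: upd[OF that] Vector_Spaces.linear_iff)
  show "coord_form \<alpha> \<beta> S A f = coord_form \<alpha> \<beta> S A g" if "\<And>s. s \<in> S \<Longrightarrow> f s = g s" for f g
    unfolding coord_form_def using that by (intro prod.cong) auto
qed

lemma multilinear_on_diff:
  assumes "multilinear_on scale S \<phi>" "multilinear_on scale S \<psi>"
  shows "multilinear_on scale S (\<lambda>f. \<phi> f - \<psi> f)"
  using multilinear_on_add[OF assms(1) multilinear_on_scale[OF assms(2), of "- 1"]] by simp

lemma finite_tri_pos: "finite (tri_pos m)"
  by (rule finite_subset[of _ "{..<m} \<times> {..<m}"]) (auto simp: tri_pos_def)

lemma tri_pos_3: "tri_pos 3 = {(1, 2)}"
  by (auto simp: tri_pos_def)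

lemma tri_pos_5: "tri_pos 5 = {(1, 2), (1, 3), (1, 4), (2, 3), (2, 4), (3, 4)}"
  unfolding tri_pos_def set_eq_iff by (clarsimp, presburger)

section \<open>Vanishing for \<open>m\<close> above 5\<close>

lemma two_colours_eq:
  "u \<in> {a, b} \<Longrightarrow> v \<in> {a, b} \<Longrightarrow> (u = a) = (v = a) \<Longrightarrow> u = v"
  by (metis insertE singletonD)

text \<open>With two colours, agreeing on being \<open>a\<close> means being equal; this makes the
  graph argument Boolean.\<close>

lemma mono_triangle_coloursI:
  assumes "\<And>s. s \<in> tri_pos m \<Longrightarrow> f s \<in> {a, b}" and "mono_triangle m (\<lambda>s. f s = a)"
  shows "mono_triangle m f"
proof -
  from assms(2) obtain x y z where xyz: "1 \<le> x" "x < y" "y < z" "z < m"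
    and eq: "(f (x, y) = a) = (f (x, z) = a)" "(f (x, z) = a) = (f (y, z) = a)"
    unfolding mono_triangle_def by blast
  have ab: "f (x, y) \<in> {a, b}" "f (x, z) \<in> {a, b}" "f (y, z) \<in> {a, b}"
    by (rule assms(1), use xyz in \<open>simp add: tri_pos_def\<close>)+
  show ?thesis
    by (rule mono_triangleI[OF xyz two_colours_eq[OF ab(1,2) eq(1)] two_colours_eq[OF ab(2,3) eq(2)]])
qed

text \<open>Without a monochromatic triangle every vertex of K_5 meets two edges of each colour. The
  edges from 1, 2, 3 to 4, 5 therefore fix how many edges of a given colour each of 1, 2, 3 has
  inside the triangle 1, 2, 3, and these three numbers determine its edges.\<close>

lemma K5_triangle_recolouring:
  fixes c d :: "nat \<times> nat \<Rightarrow> bool"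
  assumes "\<not> mono_triangle 6 c" "\<not> mono_triangle 6 d"
    and "d (1, 4) = c (1, 4)" "d (1, 5) = c (1, 5)" "d (2, 4) = c (2, 4)" "d (2, 5) = c (2, 5)"
      "d (3, 4) = c (3, 4)" "d (3, 5) = c (3, 5)"
  shows "d (1, 2) = c (1, 2)" "d (1, 3) = c (1, 3)" "d (2, 3) = c (2, 3)"
proof -
  have tri: "\<not> (e (x, y) = e (x, z) \<and> e (x, z) = e (y, z))"
    if "\<not> mono_triangle 6 e" "1 \<le> x" "x < y" "y < z" "z < 6" for e :: "nat \<times> nat \<Rightarrow> bool" and x y z
    using that mono_triangleI[of x y z 6 e] by blast
  have c: "\<not> (c (1, 2) = c (1, 3) \<and> c (1, 3) = c (2, 3))" "\<not> (c (1, 2) = c (1, 4) \<and> c (1, 4) = c (2, 4))"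
    "\<not> (c (1, 2) = c (1, 5) \<and> c (1, 5) = c (2, 5))" "\<not> (c (1, 3) = c (1, 4) \<and> c (1, 4) = c (3, 4))"
    "\<not> (c (1, 3) = c (1, 5) \<and> c (1, 5) = c (3, 5))" "\<not> (c (1, 4) = c (1, 5) \<and> c (1, 5) = c (4, 5))"
    "\<not> (c (2, 3) = c (2, 4) \<and> c (2, 4) = c (3, 4))" "\<not> (c (2, 3) = c (2, 5) \<and> c (2, 5) = c (3, 5))"
    "\<not> (c (2, 4) = c (2, 5) \<and> c (2, 5) = c (4, 5))" "\<not> (c (3, 4) = c (3, 5) \<and> c (3, 5) = c (4, 5))"
    by (rule tri[OF assms(1)]; simp)+
  have d: "\<not> (d (1, 2) = d (1, 3) \<and> d (1, 3) = d (2, 3))" "\<not> (d (1, 2) = d (1, 4) \<and> d (1, 4) = d (2, 4))"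
    "\<not> (d (1, 2) = d (1, 5) \<and> d (1, 5) = d (2, 5))" "\<not> (d (1, 3) = d (1, 4) \<and> d (1, 4) = d (3, 4))"
    "\<not> (d (1, 3) = d (1, 5) \<and> d (1, 5) = d (3, 5))" "\<not> (d (2, 3) = d (2, 4) \<and> d (2, 4) = d (3, 4))"
    "\<not> (d (2, 3) = d (2, 5) \<and> d (2, 5) = d (3, 5))"
    by (rule tri[OF assms(2)]; simp)+
  \<comment> \<open>With the shared edges identified this is a finite propositional problem.\<close>
  show "d (1, 2) = c (1, 2)" "d (1, 3) = c (1, 3)" "d (2, 3) = c (2, 3)"
    using c d[unfolded assms(3-8)] by sat+
qed

text \<open>For a colouring \<open>f\<close> without monochromatic triangle, put
  \<open>a + b\<close> at the three positions of the triangle 1, 2, 3. The result lies in the ideal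
  and expands into eight colourings, of which all but \<open>f\<close> have a monochromatic
  triangle.\<close>

lemma simple_tensor_in_ES_6:
  fixes scale :: "'k::field \<Rightarrow> 'v::ab_group_add \<Rightarrow> 'v" and a b :: 'v
  assumes V: "vector_space scale" and ab: "a \<noteq> b" and span: "Modules.module.span scale {a, b} = UNIV"
  shows "simple_tensor scale (tri_pos 6) f \<in> ES scale 6"
proof (rule simple_tensor_in_subspaceI[OF V finite_tri_pos span])
  show E: "fun_vs.subspace (ES scale 6)" by (rule subspace_ES[OF V]) simp
  fix f assume f: "\<And>s. s \<in> tri_pos 6 \<Longrightarrow> f s \<in> {a, b}"
  show "simple_tensor scale (tri_pos 6) f \<in> ES scale 6"
  proof (cases "mono_triangle 6 f")
    case True
    then show ?thesis by (rule mono_triangle_in_ES[OF V])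
  next
    case False
    define h where "h u v w = f((1, 2) := u, (1, 3) := v, (2, 3) := w)" for u v w
    define T where "T u v w = simple_tensor scale (tri_pos 6) (h u v w)" for u v w
    let ?I = "{a, b} \<times> {a, b} \<times> {a, b}" and ?t = "(f (1, 2), f (1, 3), f (2, 3))"
    let ?T = "\<lambda>(u, v, w). T u v w"
    have pos: "(1, 2) \<in> tri_pos 6" "(1, 3) \<in> tri_pos 6" "(2, 3) \<in> tri_pos 6"
      "distinct [(1, 2), (1, 3), (2, 3 :: nat) :: nat \<times> nat]"
      by (auto simp: tri_pos_def)
    note T = T_def[unfolded h_def]
    have T_ES: "T u v w \<in> ES scale 6" if uvw: "u \<in> {a, b}" "v \<in> {a, b}" "w \<in> {a, b}"
      and ne: "(u, v, w) \<noteq> ?t" for u v w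
      unfolding T_def
    proof (rule mono_triangle_in_ES[OF V], rule ccontr)
      assume h: "\<not> mono_triangle 6 (h u v w)"
      have h_ab: "h u v w s \<in> {a, b}" if "s \<in> tri_pos 6" for s
        using f[OF that] uvw by (simp add: h_def)
      have "\<not> mono_triangle 6 (\<lambda>s. f s = a)" "\<not> mono_triangle 6 (\<lambda>s. h u v w s = a)"
        using False h mono_triangle_coloursI[of 6 f a b, OF f]
          mono_triangle_coloursI[of 6 "h u v w" a b, OF h_ab] by blast+
      from K5_triangle_recolouring[OF this]
      have eq: "(u = a) = (f (1, 2) = a)" "(v = a) = (f (1, 3) = a)" "(w = a) = (f (2, 3) = a)"
        by (simp_all add: h_def)
      show False
        using ne two_colours_eq[OF uvw(1) f[OF pos(1)] eq(1)] two_colours_eq[OF uvw(2) f[OF pos(2)] eq(2)]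
          two_colours_eq[OF uvw(3) f[OF pos(3)] eq(3)] by simp
    qed
    \<comment> \<open>The seven recolourings of the triangle other than \<open>f\<close>
      itself.\<close>
    define R where "R = (\<Sum>t\<in>?I - {?t}. ?T t)"
    have R: "R \<in> ES scale 6"
      unfolding R_def
    proof (rule fun_vs.subspace_sum[OF E])
      fix t assume t: "t \<in> ?I - {?t}"
      obtain u v w where uvw: "t = (u, v, w)" by (cases t)
      show "?T t \<in> ES scale 6"
        using t unfolding uvw prod.case by (intro T_ES) blast+
    qed
    note tri = simple_tensor_trilinear[OF V pos T]
    have "(\<Sum>t\<in>?I. ?T t) = (\<Sum>u\<in>{a, b}. \<Sum>v\<in>{a, b}. \<Sum>w\<in>{a, b}. T u v w)"
      by (simp only: sum.cartesian_product)
    \<comment> \<open>Trilinearity read backwards; \<open>a\<close> and \<open>b\<close> being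
      distinct, each sum has two terms.\<close>
    also have "\<dots> = T (a + b) (a + b) (a + b)"
      using ab by (simp add: tri(1)[symmetric] tri(2)[symmetric] tri(3)[symmetric])
    also have "\<dots> \<in> ES scale 6"
      by (rule triangle_diagonal_in_ES[OF V _ _ _ _ T]) simp_all
    finally have "(\<Sum>t\<in>?I. ?T t) \<in> ES scale 6" .
    moreover have "(\<Sum>t\<in>?I. ?T t) = ?T ?t + R"
      unfolding R_def by (rule sum.remove) (simp, intro SigmaI f pos)
    ultimately have "?T ?t + R - R \<in> ES scale 6"
      by (intro fun_vs.subspace_diff[OF E] R) (simp only:)
    then have "T (f (1, 2)) (f (1, 3)) (f (2, 3)) \<in> ES scale 6"
      by (simp only: add_diff_cancel_right' prod.case)
    then show ?thesis by (simp add: T_def h_def)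
  qed
qed

text \<open>Deleting the last index leaves a tensor that is in the ideal by induction, and
  \<open>ES_insert_index\<close> puts the index back.\<close>

lemma simple_tensor_in_ES:
  fixes scale :: "'k::field \<Rightarrow> 'v::ab_group_add \<Rightarrow> 'v" and a b :: 'v
  assumes V: "vector_space scale" and ab: "a \<noteq> b" and span: "Modules.module.span scale {a, b} = UNIV"
    and m: "6 \<le> m"
  shows "simple_tensor scale (tri_pos m) f \<in> ES scale m"
  using m
proof (induction m arbitrary: f rule: nat_induct_at_least)
  case base
  show ?case by (rule simple_tensor_in_ES_6[OF V ab span])
next
  case (Suc m)
  then show ?case by (intro ES_insert_index[OF V, of m m]) auto
qed

section \<open>Spanning sets for \<open>m = 4\<close> and \<open>m = 5\<close>\<close>

text \<open>Applied to triangle relations: the number of the fact selects the summand that is solved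
  for.\<close>

lemma last_of_three:
  assumes "fun_vs.subspace M" "x + y + z \<in> M"
  shows "y \<in> M \<Longrightarrow> z \<in> M \<Longrightarrow> x \<in> M" "x \<in> M \<Longrightarrow> z \<in> M \<Longrightarrow> y \<in> M" "x \<in> M \<Longrightarrow> y \<in> M \<Longrightarrow> z \<in> M"
proof -
  note diff = fun_vs.subspace_diff[OF assms(1)]
  have "x = x + y + z - z - y" "y = x + y + z - z - x" "z = x + y + z - x - y"
    by (simp_all add: algebra_simps)
  then show "y \<in> M \<Longrightarrow> z \<in> M \<Longrightarrow> x \<in> M" "x \<in> M \<Longrightarrow> z \<in> M \<Longrightarrow> y \<in> M" "x \<in> M \<Longrightarrow> y \<in> M \<Longrightarrow> z \<in> M"
    using diff assms(2) by metis+
qed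

context
  fixes scale :: "'k::field \<Rightarrow> 'v::ab_group_add \<Rightarrow> 'v" and a b :: 'v and c :: 'k
  assumes V: "vector_space scale" and span: "Modules.module.span scale {a, b} = UNIV"
    and c: "c \<noteq> 0" "c \<noteq> 1"
begin

text \<open>Of the eight colourings two are monochromatic and four are listed; each of the two
  relations at the only triangle contains exactly one of the remaining two.\<close>

lemma spanning_4:
  "simple_tensor scale (tri_pos 4) f \<in> fun_vs.span (upper_tensor scale 4 `
     {[[a, a], [b]], [[a, b], [a]], [[b, b], [a]], [[a, b], [b]]} \<union> ES scale 4)"
    (is "_ \<in> fun_vs.span (_ ` ?us \<union> _)")
proof -
  define M where "M = fun_vs.span (upper_tensor scale 4 ` ?us \<union> ES scale 4)"
  define T where "T u v w = upper_tensor scale 4 [[u, v], [w]]" for u v w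
  have M: "fun_vs.subspace M" by (simp add: M_def)
  have E: "x \<in> M" if "x \<in> ES scale 4" for x
    using that by (simp add: M_def fun_vs.span_base)
  \<comment> \<open>The entries \<open>a\<close> are placeholders, overwritten by the
    updates.\<close>
  have T_upd: "T u v w = simple_tensor scale (tri_pos 4)
      ((upper_matrix [[a, a], [a]])((1, 2) := u, (1, 3) := v, (2, 3) := w))" for u v w
    unfolding T_def upper_tensor_def
    by (rule simple_tensor_cong) (auto simp: tri_pos_4 upper_matrix_def)
  have diag: "T u u u \<in> M" for u
    by (rule E, rule triangle_diagonal_in_ES[OF V _ _ _ _ T_upd]) simp_all
  have gens: "T a a b \<in> M" "T a b a \<in> M" "T b b a \<in> M" "T a b b \<in> M"
    unfolding T_def M_def by (rule fun_vs.span_base, simp)+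
  have "T a a b + T a b a + T b a a \<in> M" "T a b b + T b a b + T b b a \<in> M"
    by (rule E, rule triangle_relations[OF V _ _ _ _ T_upd c]; simp)+
  then have "T b a a \<in> M" "T b a b \<in> M"
    using last_of_three[OF M] gens by blast+
  note all = diag gens this
  show ?thesis
    unfolding M_def[symmetric]
  proof (rule simple_tensor_in_subspaceI[OF V finite_tri_pos span M])
    fix f assume f: "\<And>s. s \<in> tri_pos 4 \<Longrightarrow> f s \<in> {a, b}"
    have "simple_tensor scale (tri_pos 4) f = T (f (1, 2)) (f (1, 3)) (f (2, 3))"
      unfolding T_def upper_tensor_def
      by (rule simple_tensor_cong) (auto simp: tri_pos_4 upper_matrix_def)
    moreover have "f (1, 2) \<in> {a, b}" "f (1, 3) \<in> {a, b}" "f (2, 3) \<in> {a, b}"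
      by (rule f, simp add: tri_pos_4)+
    ultimately show "simple_tensor scale (tri_pos 4) f \<in> M" using all by auto
  qed
qed

text \<open>Starting from the single listed colouring, the path 1, 2, 3, 4 in colour
  \<open>a\<close>, the relations at the four triangles of K_4 reach one colouring after
  another.\<close>

lemma spanning_5:
  "simple_tensor scale (tri_pos 5) f \<in>
     fun_vs.span (upper_tensor scale 5 ` {[[a, b, b], [a, b], [a]]} \<union> ES scale 5)"
    (is "_ \<in> fun_vs.span (_ ` ?us \<union> _)")
proof -
  define M where "M = fun_vs.span (upper_tensor scale 5 ` ?us \<union> ES scale 5)"
  define T where "T p12 p13 p14 p23 p24 p34 = upper_tensor scale 5 [[p12, p13, p14], [p23, p24], [p34]]"
    for p12 p13 p14 p23 p24 p34
  have M: "fun_vs.subspace M" by (simp add: M_def)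
  have E: "x \<in> M" if "x \<in> ES scale 5" for x
    using that by (simp add: M_def fun_vs.span_base)
  \<comment> \<open>One form of \<open>T\<close> for each of the triangles 123, 124, 134, 234; the
    entries \<open>a\<close> on the right are placeholders that get overwritten.\<close>
  have T_upd:
    "T u v p14 w p24 p34 = simple_tensor scale (tri_pos 5)
      ((upper_matrix [[a, a, p14], [a, p24], [p34]])((1, 2) := u, (1, 3) := v, (2, 3) := w))"
    "T u p13 v p23 w p34 = simple_tensor scale (tri_pos 5)
      ((upper_matrix [[a, p13, a], [p23, a], [p34]])((1, 2) := u, (1, 4) := v, (2, 4) := w))"
    "T p12 u v p23 p24 w = simple_tensor scale (tri_pos 5)
      ((upper_matrix [[p12, a, a], [p23, p24], [a]])((1, 3) := u, (1, 4) := v, (3, 4) := w))"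
    "T p12 p13 p14 u v w = simple_tensor scale (tri_pos 5)
      ((upper_matrix [[p12, p13, p14], [a, a], [a]])((2, 3) := u, (2, 4) := v, (3, 4) := w))"
    for u v w p12 p13 p14 p23 p24 p34
    unfolding T_def upper_tensor_def
    by (rule simple_tensor_cong, auto simp: tri_pos_5 upper_matrix_def)+
  have mono: "T u u p14 u p24 p34 \<in> M" "T u p13 u p23 u p34 \<in> M"
    "T p12 u u p23 p24 u \<in> M" "T p12 p13 p14 u u u \<in> M"
    for u p12 p13 p14 p23 p24 p34
    by (rule E, rule triangle_diagonal_in_ES[OF V _ _ _ _ T_upd(1)]
        triangle_diagonal_in_ES[OF V _ _ _ _ T_upd(2)] triangle_diagonal_in_ES[OF V _ _ _ _ T_upd(3)]
        triangle_diagonal_in_ES[OF V _ _ _ _ T_upd(4)]; simp)+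
  have R123: "T a a p14 b p24 p34 + T a b p14 a p24 p34 + T b a p14 a p24 p34 \<in> M"
    "T a b p14 b p24 p34 + T b a p14 b p24 p34 + T b b p14 a p24 p34 \<in> M"
    for p14 p24 p34
    by (rule E, rule triangle_relations[OF V _ _ _ _ T_upd(1) c]; simp)+
  have R124: "T a p13 a p23 b p34 + T a p13 b p23 a p34 + T b p13 a p23 a p34 \<in> M"
    "T a p13 b p23 b p34 + T b p13 a p23 b p34 + T b p13 b p23 a p34 \<in> M"
    for p13 p23 p34
    by (rule E, rule triangle_relations[OF V _ _ _ _ T_upd(2) c]; simp)+
  have R134: "T p12 a a p23 p24 b + T p12 a b p23 p24 a + T p12 b a p23 p24 a \<in> M"
    "T p12 a b p23 p24 b + T p12 b a p23 p24 b + T p12 b b p23 p24 a \<in> M"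
    for p12 p23 p24
    by (rule E, rule triangle_relations[OF V _ _ _ _ T_upd(3) c]; simp)+
  have R234: "T p12 p13 p14 a a b + T p12 p13 p14 a b a + T p12 p13 p14 b a a \<in> M"
    "T p12 p13 p14 a b b + T p12 p13 p14 b a b + T p12 p13 p14 b b a \<in> M"
    for p12 p13 p14
    by (rule E, rule triangle_relations[OF V _ _ _ _ T_upd(4) c]; simp)+
  have w0: "T a b b a b a \<in> M"
    unfolding T_def M_def by (rule fun_vs.span_base) simp
  \<comment> \<open>Each step solves a triangle relation for its only term not yet known to lie in \<open>M\<close>.\<close>
  have t1: "T b a a a a b \<in> M"
    by (rule last_of_three(3)[OF M R123(1)]; (rule w0 mono))
  have t2: "T a b a a b a \<in> M"
    by (rule last_of_three(2)[OF M R123(1)]; (rule w0 t1 mono))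
  have t3: "T b b a a b b \<in> M"
    by (rule last_of_three(3)[OF M R123(2)]; (rule w0 t1 t2 mono))
  have t4: "T a a b b a a \<in> M"
    by (rule last_of_three(1)[OF M R123(1)]; (rule w0 t1 t2 t3 mono))
  have t5: "T b a b b a b \<in> M"
    by (rule last_of_three(2)[OF M R123(2)]; (rule w0 t1 t2 t3 t4 mono))
  have t6: "T a a b b b a \<in> M"
    by (rule last_of_three(1)[OF M R123(1)]; (rule w0 t1 t2 t3 t4 t5 mono))
  have t7: "T a b b b b a \<in> M"
    by (rule last_of_three(1)[OF M R123(2)]; (rule w0 t1 t2 t3 t4 t5 t6 mono))
  have t8: "T b a b b a a \<in> M"
    by (rule last_of_three(3)[OF M R124(2)]; (rule w0 t1 t2 t3 t4 t5 t6 t7 mono))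
  have t9: "T b b a a b a \<in> M"
    by (rule last_of_three(2)[OF M R124(2)]; (rule w0 t1 t2 t3 t4 t5 t6 t7 t8 mono))
  have t10: "T a b a a b b \<in> M"
    by (rule last_of_three(2)[OF M R134(2)]; (rule w0 t1 t2 t3 t4 t5 t6 t7 t8 t9 mono))
  have t11: "T a b a b b a \<in> M"
    by (rule last_of_three(3)[OF M R134(1)]; (rule w0 t1 t2 t3 t4 t5 t6 t7 t8 t9 t10 mono))
  have t12: "T b a a a b b \<in> M"
    by (rule last_of_three(1)[OF M R134(1)]; (rule w0 t1 t2 t3 t4 t5 t6 t7 t8 t9 t10 t11 mono))
  have t13: "T b a a b a b \<in> M"
    by (rule last_of_three(1)[OF M R134(1)]; (rule w0 t1 t2 t3 t4 t5 t6 t7 t8 t9 t10 t11 t12 mono))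
  have t14: "T a a b b a b \<in> M"
    by (rule last_of_three(2)[OF M R234(2)]; (rule w0 t1 t2 t3 t4 t5 t6 t7 t8 t9 t10 t11 t12 t13 mono))
  have t15: "T a b b b a a \<in> M"
    by (rule last_of_three(3)[OF M R234(1)]; (rule w0 t1 t2 t3 t4 t5 t6 t7 t8 t9 t10 t11 t12 t13 t14 mono))
  have t16: "T b a b a a b \<in> M"
    by (rule last_of_three(1)[OF M R234(1)]; (rule w0 t1 t2 t3 t4 t5 t6 t7 t8 t9 t10 t11 t12 t13 t14 t15 mono))
  have t17: "T b b a a a b \<in> M"
    by (rule last_of_three(1)[OF M R234(1)]; (rule w0 t1 t2 t3 t4 t5 t6 t7 t8 t9 t10 t11 t12 t13 t14 t15 t16 mono))
  \<comment> \<open>\<open>w0\<close> and \<open>t1\<close> to \<open>t17\<close> are the eighteen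
    colourings without monochromatic triangle, where colour \<open>a\<close> forms one of twelve
    Hamiltonian paths, three 4-cycles or three perfect matchings; \<open>mono\<close> covers the
    other 46.\<close>
  note all = w0 t1 t2 t3 t4 t5 t6 t7 t8 t9 t10 t11 t12 t13 t14 t15 t16 t17 mono
  have T_in: "T p12 p13 p14 p23 p24 p34 \<in> M"
    if "p12 \<in> {a, b}" "p13 \<in> {a, b}" "p14 \<in> {a, b}" "p23 \<in> {a, b}" "p24 \<in> {a, b}" "p34 \<in> {a, b}"
    for p12 p13 p14 p23 p24 p34
    using that by (elim insertE emptyE) (simp_all add: all)
  show ?thesis
    unfolding M_def[symmetric]
  proof (rule simple_tensor_in_subspaceI[OF V finite_tri_pos span M])
    fix f assume f: "\<And>s. s \<in> tri_pos 5 \<Longrightarrow> f s \<in> {a, b}"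
    have "simple_tensor scale (tri_pos 5) f =
        T (f (1, 2)) (f (1, 3)) (f (1, 4)) (f (2, 3)) (f (2, 4)) (f (3, 4))"
      unfolding T_def upper_tensor_def
      by (rule simple_tensor_cong) (auto simp: tri_pos_5 upper_matrix_def)
    moreover have "T (f (1, 2)) (f (1, 3)) (f (1, 4)) (f (2, 3)) (f (2, 4)) (f (3, 4)) \<in> M"
      by (rule T_in; rule f; simp add: tri_pos_5)
    ultimately show "simple_tensor scale (tri_pos 5) f \<in> M" by simp
  qed
qed

end

section \<open>Multilinear forms vanishing on monochromatic triangles\<close>

lemma not_mono_triangle_small: "m \<le> 3 \<Longrightarrow> \<not> mono_triangle m f"
  by (auto simp: mono_triangle_def)

lemma mono_triangle_4D:
  assumes "mono_triangle 4 f"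
  shows "f (1, 2) = f (2, 3)" "f (1, 3) = f (2, 3)"
proof -
  from assms obtain x y z where xyz: "1 \<le> x" "x < y" "y < z" "z < 4"
    "f (x, y) = f (x, z)" "f (x, z) = f (y, z)" unfolding mono_triangle_def by blast
  then have "x = 1" "y = 2" "z = 3" by auto
  with xyz show "f (1, 2) = f (2, 3)" "f (1, 3) = f (2, 3)" by simp_all
qed

text \<open>In each case the equations are oriented so that rewriting replaces two entries of the
  triangle by the third.\<close>

lemma mono_triangle_5_cases:
  assumes "mono_triangle 5 f"
  obtains "f (1, 2) = f (2, 3)" "f (1, 3) = f (2, 3)"
    | "f (1, 2) = f (2, 4)" "f (1, 4) = f (2, 4)"
    | "f (1, 3) = f (3, 4)" "f (1, 4) = f (3, 4)"
    | "f (2, 3) = f (3, 4)" "f (2, 4) = f (3, 4)"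
proof -
  from assms obtain x y z where xyz: "1 \<le> x" "x < y" "y < z" "z < 5"
    "f (x, y) = f (x, z)" "f (x, z) = f (y, z)" unfolding mono_triangle_def by blast
  then have "x = 1 \<and> y = 2 \<and> z = 3 \<or> x = 1 \<and> y = 2 \<and> z = 4 \<or> x = 1 \<and> y = 3 \<and> z = 4 \<or> x = 2 \<and> y = 3 \<and> z = 4"
    by presburger
  with xyz that show thesis by auto
qed

text \<open>The summands are the Hamiltonian paths of the complete graph on \<open>1, 2, 3, 4\<close>. The triangle relations
  determine the signs up to a common factor.\<close>

definition path_form :: "('v \<Rightarrow> 'k::field) \<Rightarrow> ('v \<Rightarrow> 'k) \<Rightarrow> (nat \<times> nat \<Rightarrow> 'v) \<Rightarrow> 'k" where
  "path_form \<alpha> \<beta> f =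
       coord_form \<alpha> \<beta> (tri_pos 5) {(1, 2), (1, 3), (2, 4)} f
      + coord_form \<alpha> \<beta> (tri_pos 5) {(1, 2), (1, 4), (3, 4)} f
      + coord_form \<alpha> \<beta> (tri_pos 5) {(1, 2), (2, 3), (3, 4)} f
      + coord_form \<alpha> \<beta> (tri_pos 5) {(1, 3), (1, 4), (2, 3)} f
      + coord_form \<alpha> \<beta> (tri_pos 5) {(1, 3), (2, 4), (3, 4)} f
      + coord_form \<alpha> \<beta> (tri_pos 5) {(1, 4), (2, 3), (2, 4)} f
      - coord_form \<alpha> \<beta> (tri_pos 5) {(1, 2), (1, 3), (3, 4)} f
      - coord_form \<alpha> \<beta> (tri_pos 5) {(1, 2), (1, 4), (2, 3)} f
      - coord_form \<alpha> \<beta> (tri_pos 5) {(1, 2), (2, 4), (3, 4)} f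
      - coord_form \<alpha> \<beta> (tri_pos 5) {(1, 3), (1, 4), (2, 4)} f
      - coord_form \<alpha> \<beta> (tri_pos 5) {(1, 3), (2, 3), (2, 4)} f
      - coord_form \<alpha> \<beta> (tri_pos 5) {(1, 4), (2, 3), (3, 4)} f"

lemma multilinear_path_form:
  assumes "vector_space scale"
    and "Vector_Spaces.linear scale (*) \<alpha>" "Vector_Spaces.linear scale (*) \<beta>"
  shows "multilinear_on scale (tri_pos 5) (path_form \<alpha> \<beta>)"
  unfolding path_form_def[abs_def]
  by (rule multilinear_on_diff multilinear_on_add multilinear_coord_form[OF assms(1) finite_tri_pos assms(2,3)])+

lemma coord_form_4:
  "coord_form \<alpha> \<beta> (tri_pos 4) A f =
    (if (1, 2) \<in> A then \<alpha> (f (1, 2)) else \<beta> (f (1, 2))) * (if (1, 3) \<in> A then \<alpha> (f (1, 3)) else \<beta> (f (1, 3))) *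
    (if (2, 3) \<in> A then \<alpha> (f (2, 3)) else \<beta> (f (2, 3)))"
  by (simp add: coord_form_def tri_pos_4 mult.assoc)

lemma coord_form_5:
  "coord_form \<alpha> \<beta> (tri_pos 5) A f =
    (if (1, 2) \<in> A then \<alpha> (f (1, 2)) else \<beta> (f (1, 2))) * (if (1, 3) \<in> A then \<alpha> (f (1, 3)) else \<beta> (f (1, 3))) *
    (if (1, 4) \<in> A then \<alpha> (f (1, 4)) else \<beta> (f (1, 4))) * (if (2, 3) \<in> A then \<alpha> (f (2, 3)) else \<beta> (f (2, 3))) *
    (if (2, 4) \<in> A then \<alpha> (f (2, 4)) else \<beta> (f (2, 4))) * (if (3, 4) \<in> A then \<alpha> (f (3, 4)) else \<beta> (f (3, 4)))"
  by (simp add: coord_form_def tri_pos_5 mult.assoc)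

text \<open>Once the three entries of a triangle are equal, a summand depends only on which edges
  outside the triangle its path has and on how many inside. The twelve summands then cancel in pairs
  of opposite sign.\<close>

lemma path_form_mono_triangle:
  assumes "mono_triangle 5 f"
  shows "path_form \<alpha> \<beta> f = 0"
  using mono_triangle_5_cases[OF assms]
proof cases
  case 1
  show ?thesis unfolding path_form_def coord_form_5 1 by (simp, algebra)
next
  case 2
  show ?thesis unfolding path_form_def coord_form_5 2 by (simp, algebra)
next
  case 3
  show ?thesis unfolding path_form_def coord_form_5 3 by (simp, algebra)
next
  case 4
  show ?thesis unfolding path_form_def coord_form_5 4 by (simp, algebra)
qed

section \<open>Vanishing and bases in each degree\<close>

theorem proposition3p3:
  fixes scale :: "'k::field \<Rightarrow> 'v::ab_group_add \<Rightarrow> 'v" and a b :: 'v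
  assumes "vector_space scale"
    and "a \<noteq> b"
    and "\<not> Modules.module.dependent scale {a, b}"
    and "Modules.module.span scale {a, b} = UNIV"
  shows "(\<forall>m>5. carrier (Lam scale m) = {\<zero>\<^bsub>Lam scale m\<^esub>}) \<and>
    Lam_basis scale 1 [wedge scale 1 []] \<and>
    Lam_basis scale 2 [wedge scale 2 []] \<and>
    Lam_basis scale 3 [wedge scale 3 [[a]], wedge scale 3 [[b]]] \<and>
    ((\<exists>c::'k. c \<noteq> 0 \<and> c \<noteq> 1) \<longrightarrow>
      Lam_basis scale 4
        [wedge scale 4 [[a, a],
                           [b]],
         wedge scale 4 [[a, b],
                           [a]],
         wedge scale 4 [[b, b],
                           [a]],
         wedge scale 4 [[a, b],
                           [b]]] \<and>
      Lam_basis scale 5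
        [wedge scale 5 [[a, b, b],
                           [a, b],
                              [a]]])"
proof (intro conjI allI impI)
  note V = assms(1) and ab = assms(2) and span = assms(4)
  interpret V: vector_space scale by fact
  interpret k: vector_space "(*) :: 'k \<Rightarrow> 'k \<Rightarrow> 'k" by (rule vector_space_mult)
  interpret P: vector_space_pair scale "(*) :: 'k \<Rightarrow> 'k \<Rightarrow> 'k" ..
  obtain \<alpha> where \<alpha>: "Vector_Spaces.linear scale (*) \<alpha>" "\<alpha> a = 1" "\<alpha> b = (0::'k)"
    using P.linear_independent_extend[OF assms(3), of "\<lambda>x. if x = a then 1 else 0"] ab by auto
  obtain \<beta> where \<beta>: "Vector_Spaces.linear scale (*) \<beta>" "\<beta> a = (0::'k)" "\<beta> b = 1"
    using P.linear_independent_extend[OF assms(3), of "\<lambda>x. if x = b then 1 else 0"] ab by auto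
  note ml = multilinear_coord_form[OF V finite_tri_pos \<alpha>(1) \<beta>(1)]
  let ?c = "\<lambda>m. coord_form \<alpha> \<beta> (tri_pos m)"
  show "carrier (Lam scale m) = {\<zero>\<^bsub>Lam scale m\<^esub>}" if "5 < m" for m
  proof -
    have E: "fun_vs.subspace (ES scale m)" using that by (intro subspace_ES[OF V]) simp
    have "TS scale m \<subseteq> ES scale m"
      unfolding TS_def tensor_power_def
      using simple_tensor_in_ES[OF V ab span] that by (intro fun_vs.span_minimal E) auto
    then have "fcoset (ES scale m) x = ES scale m" if "x \<in> TS scale m" for x
      using that fcoset_eq_iff[OF E, of x 0] by (auto simp: fcoset_def)
    moreover have "0 \<in> TS scale m" by (rule fun_vs.subspace_0[OF subspace_TS])
    ultimately show ?thesis by (auto simp: Lam_def quotient_space_def)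
  qed
  have small: "Lam_basis scale m [wedge scale m []]" if "1 \<le> m" "tri_pos m = {}" for m
  proof -
    have "Lam_basis scale m (map (wedge scale m) [[]])"
    \<comment> \<open>With no positions the form \<open>?c m {}\<close> is the empty product, the
      constant 1.\<close>
    proof (rule Lam_basisI[OF V that(1), where \<phi>s = "[?c m {}]"])
      show "simple_tensor scale (tri_pos m) f \<in>
          fun_vs.span (set (map (upper_tensor scale m) [[]]) \<union> ES scale m)" for f
        using simple_tensor_cong[of "tri_pos m" f "upper_matrix []" scale]
        by (intro fun_vs.span_base) (simp add: upper_tensor_def that(2))
      show "\<phi> f = 0" if "mono_triangle m f" for \<phi> f
        using that \<open>tri_pos m = {}\<close> by (auto simp: mono_triangle_def tri_pos_def)
      show "multilinear_on scale (tri_pos m) \<phi>" if "\<phi> \<in> set [?c m {}]" for \<phi>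
        using that ml by simp
    qed (simp_all add: coord_form_def that(2))
    then show ?thesis by simp
  qed
  show "Lam_basis scale 1 [wedge scale 1 []]" "Lam_basis scale 2 [wedge scale 2 []]"
    by (rule small; simp only: empty_pos; simp)+
  show "Lam_basis scale 3 [wedge scale 3 [[a]], wedge scale 3 [[b]]]"
  proof -
    have "Lam_basis scale 3 (map (wedge scale 3) [[[a]], [[b]]])"
    proof (rule Lam_basisI[OF V, where \<phi>s = "[?c 3 {(1, 2)}, ?c 3 {}]"])
      let ?M = "fun_vs.span (set (map (upper_tensor scale 3) [[[a]], [[b]]]) \<union> ES scale 3)"
      show "simple_tensor scale (tri_pos 3) f \<in> ?M" for f
      proof (rule simple_tensor_in_subspaceI[OF V finite_tri_pos span])
        fix f assume f: "\<And>s. s \<in> tri_pos 3 \<Longrightarrow> f s \<in> {a, b}"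
        have "simple_tensor scale (tri_pos 3) f = upper_tensor scale 3 [[f (1, 2)]]"
          unfolding upper_tensor_def
          by (rule simple_tensor_cong) (auto simp: tri_pos_3 upper_matrix_def)
        then show "simple_tensor scale (tri_pos 3) f \<in> ?M"
          using f[of "(1, 2)"] by (auto simp: tri_pos_3 intro!: fun_vs.span_base)
      qed simp
      show "multilinear_on scale (tri_pos 3) \<phi>" if "\<phi> \<in> set [?c 3 {(1, 2)}, ?c 3 {}]" for \<phi>
        using that ml by auto
      show "([?c 3 {(1, 2)}, ?c 3 {}] ! j) (upper_matrix ([[[a]], [[b]]] ! i)) = (if i = j then 1 else 0)"
        if "i < length [[[a]], [[b]]]" "j < length [[[a]], [[b]]]" for i j
      proof -
        from that have "i \<in> {0, 1}" "j \<in> {0, 1}" by auto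
        then show ?thesis by (auto simp: coord_form_def tri_pos_3 upper_matrix_def \<alpha> \<beta>)
      qed
    qed (simp_all add: not_mono_triangle_small)
    then show ?thesis by simp
  qed
  assume "\<exists>c::'k. c \<noteq> 0 \<and> c \<noteq> 1"
  then obtain c :: 'k where c: "c \<noteq> 0" "c \<noteq> 1" by blast
  show "Lam_basis scale 4
      [wedge scale 4 [[a, a], [b]], wedge scale 4 [[a, b], [a]],
       wedge scale 4 [[b, b], [a]], wedge scale 4 [[a, b], [b]]]"
  proof -
    \<comment> \<open>Each form is the coordinate of a listed colouring minus that of the unlisted
      colouring in the same triangle relation, \<open>baa\<close> or \<open>bab\<close>. On three
      equal entries the two terms agree.\<close>
    let ?\<phi>s = "[\<lambda>f. ?c 4 {(1, 2), (1, 3)} f - ?c 4 {(1, 3), (2, 3)} f,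
      \<lambda>f. ?c 4 {(1, 2), (2, 3)} f - ?c 4 {(1, 3), (2, 3)} f,
      \<lambda>f. ?c 4 {(2, 3)} f - ?c 4 {(1, 3)} f,
      \<lambda>f. ?c 4 {(1, 2)} f - ?c 4 {(1, 3)} f]"
    have "Lam_basis scale 4
      (map (wedge scale 4) [[[a, a], [b]], [[a, b], [a]], [[b, b], [a]], [[a, b], [b]]])"
    proof (rule Lam_basisI[OF V, where \<phi>s = ?\<phi>s])
      show "\<phi> f = 0" if "\<phi> \<in> set ?\<phi>s" "mono_triangle 4 f" for \<phi> f
        using that(1) mono_triangle_4D[OF that(2)] by (auto simp: coord_form_4)
      show "multilinear_on scale (tri_pos 4) \<phi>" if "\<phi> \<in> set ?\<phi>s" for \<phi>
        using that by (auto intro!: multilinear_on_diff ml)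
      show "(?\<phi>s ! j) (upper_matrix ([[[a, a], [b]], [[a, b], [a]], [[b, b], [a]], [[a, b], [b]]] ! i)) =
          (if i = j then 1 else 0)"
        if "i < length [[[a, a], [b]], [[a, b], [a]], [[b, b], [a]], [[a, b], [b]]]"
          "j < length [[[a, a], [b]], [[a, b], [a]], [[b, b], [a]], [[a, b], [b]]]" for i j
      proof -
        from that have "i \<in> {0, 1, 2, 3}" "j \<in> {0, 1, 2, 3}" by auto
        then show ?thesis
          by (elim insertE emptyE) (simp_all add: coord_form_4 upper_matrix_def \<alpha> \<beta>)
      qed
    qed (use spanning_4[OF V span c] in simp_all)
    then show ?thesis by simp
  qed
  show "Lam_basis scale 5 [wedge scale 5 [[a, b, b], [a, b], [a]]]"
  proof -
    have "Lam_basis scale 5 (map (wedge scale 5) [[[a, b, b], [a, b], [a]]])"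
    proof (rule Lam_basisI[OF V, where \<phi>s = "[path_form \<alpha> \<beta>]"])
      show "\<psi> f = 0" if "\<psi> \<in> set [path_form \<alpha> \<beta>]" "mono_triangle 5 f" for \<psi> f
        using that path_form_mono_triangle by simp
      show "multilinear_on scale (tri_pos 5) \<psi>" if "\<psi> \<in> set [path_form \<alpha> \<beta>]" for \<psi>
        using that multilinear_path_form[OF V \<alpha>(1) \<beta>(1)] by simp
      show "([path_form \<alpha> \<beta>] ! j) (upper_matrix ([[[a, b, b], [a, b], [a]]] ! i)) = (if i = j then 1 else 0)"
        if "i < length [[[a, b, b], [a, b], [a]]]" "j < length [[[a, b, b], [a, b], [a]]]" for i j
        using that by (simp add: path_form_def coord_form_5 upper_matrix_def \<alpha> \<beta>)
    qed (use spanning_5[OF V span c] in simp_all)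
    then show ?thesis by simp
  qed
qed

end
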